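(* Let $N\ge2$ be an integer. Then \[ \mathbb{II}_{\mathcal N}^{{\rm SU}(N)_{-N-1/2}}(x;q)=\sum_{n=0}^\infty\frac{(-1)^{Nn}q^{Nn^2/2}x^{Nn}}{(q;q)_n}, \] \[ \langle W_1\rangle^{{\rm SU}(N)_{-N-1/2}}(x;q)=\sum_{n=0}^\infty\frac{(-1)^{Nn+(N-1)}q^{\frac{Nn^2}{2}+(N-1)n+\frac{N-1}{2}}x^{Nn+(N-1)}}{(q;q)_n}. \]
   Context: Let $|q|<1$, $x$ a nonzero parameter, $(a;q)_\infty=\prod_{k\ge0}(1-aq^k)$, $(a;q)_n=\prod_{k=0}^{n-1}(1-aq^k)$. Let $s_1,\dots,s_{N-1}$ be variables and $s_N:=(s_1\cdots s_{N-1})^{-1}$. For $m\in\mathbb{Z}$ define \[ \langle W_m\rangle^{{\rm SU}(N)_{-N-1/2}}(x;q):=\frac{(q;q)_\infty^{N-1}}{N!}\oint\prod_{i=1}^{N-1}\frac{ds_i}{2\pi i s_i}\prod_{\substack{i,j=1\\ i\ne j}}^N(s_is_j^{-1};q)_\infty\prod_{i=1}^N(q^{1/2}s_ix;q)_\infty\sum_{i=1}^N s_i^m, \] where the integral denotes the constant term in $s_1,\dots,s_{N-1}$ of the integrand expanded as a formal Laurent series in the $s_i$ (equivalently the contour integral over unit circles), and $\mathbb{II}_{\mathcal N}^{{\rm SU}(N)_{-N-1/2}}(x;q):=\frac1N\langle W_0\rangle^{{\rm SU}(N)_{-N-1/2}}(x;q)$. *)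

theory Defs
  imports "HOL-Analysis.Analysis"
begin

definition qpinf :: "complex \<Rightarrow> complex \<Rightarrow> complex" where
  "qpinf a q = lim (\<lambda>n. \<Prod>k<n. (1 - a * q ^ k))"

definition qpoch :: "complex \<Rightarrow> complex \<Rightarrow> nat \<Rightarrow> complex" where
  "qpoch a q n = (\<Prod>k<n. (1 - a * q ^ k))"

definition su_s :: "nat \<Rightarrow> (nat \<Rightarrow> real) \<Rightarrow> nat \<Rightarrow> complex" where
  "su_s N \<theta> i = (if i < N - 1 then cis (\<theta> i) else inverse (\<Prod>j<N - 1. cis (\<theta> j)))"

text \<open>Wilson line W_m in SU(N)_{-N-1/2}; h plays the role of q^(1/2) (with h^2 = q).
  The contour integral over unit circles (with the 1/(2 pi i s) measure) is the normalized
  integral over the angles theta in [0,2pi]^(N-1).\<close>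
definition wilson :: "nat \<Rightarrow> int \<Rightarrow> complex \<Rightarrow> complex \<Rightarrow> complex \<Rightarrow> complex" where
  "wilson N m x q h =
     (qpinf q q) ^ (N - 1) / of_nat (fact N) *
     (integral\<^sup>L (PiM {..<N - 1} (\<lambda>_. restrict_space lborel {0..2 * pi}))
        (\<lambda>\<theta>. (\<Prod>i<N. \<Prod>j\<in>{..<N} - {i}. qpinf (su_s N \<theta> i / su_s N \<theta> j) q) *
              (\<Prod>i<N. qpinf (h * su_s N \<theta> i * x) q) *
              (\<Sum>i<N. su_s N \<theta> i powi m))
      / complex_of_real ((2 * pi) ^ (N - 1)))"

definition index_II :: "nat \<Rightarrow> complex \<Rightarrow> complex \<Rightarrow> complex \<Rightarrow> complex" where
  "index_II N x q h = wilson N 0 x q h / of_nat N"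

end

theory Submission
  imports Defs "HOL-Complex_Analysis.Complex_Analysis"
begin

text \<open>
  Write \<Delta> for the vector multiplet weight, f(z) for the product of the (z s i; q), z = h x, and e for the
  product of all N variables. A Laurent expansion in e turns the SU(N) average into the sum over n of
  the U(N) moments a(n, z) = avg (\<Delta> f(z) e^(-n)). Replacing the contour of s k by q s k and summing
  over k, which amounts to the self-adjointness of the t = 0 Macdonald operator, gives by Lagrange
  interpolation
    q^n a(n, z) = a(n, z) - (-z)^N a(n - 1, q z),
  hence a(n, z) = 0 for n < 0 and a closed form in terms of a(0, z) = avg \<Delta> for n >= 0. The same shift with
  an extra factor 1 - z s k / q expresses the moments with an insertion of the sum of the s i through a(n, z).
  Taking z = q^(-n) and n to infinity evaluates the average of \<Delta> times theta functions as
  avg \<Delta> / (q; q); this average also arises by setting one variable of the rank N + 1 weight to 1, which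
  yields avg \<Delta> by induction on the rank.
\<close>

section \<open>The infinite q-Pochhammer symbol\<close>

text \<open>Moving a single \<open>s k\<close> to \<open>q * s k\<close> is impossible on the SU(N)
  torus, where the variables multiply to 1; this forces the detour through U(N) moments. There each
  variable moves independently, and since \<open>qpinf\<close> is entire, the integrand is
  holomorphic on the punctured plane in each of them, so contours move without residues. The
  Lagrange denominators \<open>1 - s k / s j\<close> would spoil this, so no integrand contains
  them: they are stripped from the weight by passing from \<open>a\<close> to \<open>q * a\<close>
  inside \<open>qpinf\<close>. The recurrence in \<open>n\<close> determines the moments only up to
  the constant avg \<Delta>, on which it is silent, hence the separate induction on the rank. The
  shift requires \<open>q\<close> to be nonzero; if \<open>q = 0\<close> then also
  \<open>h = 0\<close>, and that case is settled by homogeneity. Half-integral powers of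
  \<open>q\<close> occur only as powers of \<open>h\<close>.\<close>

lemma qpoch_uniformly_convergent:
  fixes q :: complex
  assumes q: "norm q < 1"
  shows "uniformly_convergent_on (cball 0 r) (\<lambda>n a. \<Prod>k<n. (1 - a * q ^ k))"
proof (rule uniformly_convergent_on_prod')
  show "uniformly_convergent_on (cball 0 r) (\<lambda>N a. \<Sum>n<N. norm (1 - a * q ^ n - 1))"
  proof (rule Weierstrass_m_test')
    show "norm (norm (1 - a * q ^ n - 1)) \<le> r * norm q ^ n" if "a \<in> cball 0 r" for n a
      using that by (auto simp: norm_mult norm_power intro!: mult_right_mono)
    show "summable (\<lambda>n. r * norm q ^ n)"
      using q by (intro summable_mult summable_geometric) auto
  qed
qed (auto intro!: continuous_intros)

text \<open>Uniform convergence on discs turns the \<open>lim\<close> in the definition of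
  \<open>qpinf\<close> into a genuine limit and makes the symbol entire in \<open>a\<close>.\<close>

lemma qpinf_uniform_limit:
  assumes "norm q < 1"
  shows "uniform_limit (cball 0 r) (\<lambda>n a. \<Prod>k<n. (1 - a * q ^ k)) (\<lambda>a. qpinf a q) sequentially"
  using qpoch_uniformly_convergent[OF assms, of r]
  unfolding uniformly_convergent_uniform_limit_iff qpinf_def .

lemma qpinf_LIMSEQ:
  assumes "norm q < 1"
  shows "(\<lambda>n. \<Prod>k<n. (1 - a * q ^ k)) \<longlonglongrightarrow> qpinf a q"
  by (rule tendsto_uniform_limitI[OF qpinf_uniform_limit[OF assms, of "norm a"]]) auto

lemma qpinf_holomorphic:
  assumes "norm q < 1"
  shows "(\<lambda>a. qpinf a q) holomorphic_on A"
proof -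
  have "(\<lambda>a. qpinf a q) holomorphic_on UNIV"
  proof (rule holomorphic_uniform_sequence)
    show "(\<lambda>a. \<Prod>k<n. (1 - a * q ^ k)) holomorphic_on UNIV" for n
      by (intro holomorphic_intros)
    show "\<exists>d>0. cball x d \<subseteq> UNIV \<and>
        uniform_limit (cball x d) (\<lambda>n a. \<Prod>k<n. (1 - a * q ^ k)) (\<lambda>a. qpinf a q) sequentially" for x
      by (intro exI[of _ 1] conjI uniform_limit_on_subset[OF qpinf_uniform_limit[OF assms, of "norm x + 1"]])
         (auto simp: dist_norm, smt (verit) norm_minus_commute norm_triangle_sub)
  qed auto
  thus ?thesis
    by (rule holomorphic_on_subset) auto
qed

lemma qpinf_continuous: "norm q < 1 \<Longrightarrow> continuous_on A (\<lambda>a. qpinf a q)"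
  by (intro holomorphic_on_imp_continuous_on qpinf_holomorphic)

lemma qpinf_measurable: "norm q < 1 \<Longrightarrow> (\<lambda>a. qpinf a q) \<in> borel_measurable borel"
  by (intro borel_measurable_continuous_onI qpinf_continuous)

lemma qpinf_bounded:
  assumes "norm q < 1"
  obtains C where "\<And>a. norm a \<le> r \<Longrightarrow> norm (qpinf a q) \<le> C"
proof -
  have "compact ((\<lambda>a. qpinf a q) ` cball 0 r)"
    by (intro compact_continuous_image qpinf_continuous assms) auto
  then obtain C where "\<forall>x\<in>(\<lambda>a. qpinf a q) ` cball 0 r. norm x \<le> C"
    using compact_imp_bounded bounded_iff by blast
  thus ?thesis by (intro that[of C]) auto
qed

lemma qpinf_rec:
  assumes "norm q < 1"
  shows "qpinf a q = (1 - a) * qpinf (q * a) q"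
proof -
  have "(\<lambda>n. \<Prod>k<Suc n. (1 - a * q ^ k)) \<longlonglongrightarrow> qpinf a q"
    using qpinf_LIMSEQ[OF assms] by (rule LIMSEQ_Suc)
  also have "(\<lambda>n. \<Prod>k<Suc n. (1 - a * q ^ k)) = (\<lambda>n. (1 - a) * (\<Prod>k<n. (1 - (q * a) * q ^ k)))"
    by (simp only: prod.lessThan_Suc_shift) (simp add: mult_ac)
  finally have "(\<lambda>n. (1 - a) * (\<Prod>k<n. (1 - (q * a) * q ^ k))) \<longlonglongrightarrow> qpinf a q" .
  moreover have "(\<lambda>n. (1 - a) * (\<Prod>k<n. (1 - (q * a) * q ^ k))) \<longlonglongrightarrow> (1 - a) * qpinf (q * a) q"
    by (intro tendsto_intros qpinf_LIMSEQ assms)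
  ultimately show ?thesis
    by (rule LIMSEQ_unique)
qed

lemma qpinf_eq_qpoch:
  assumes "norm q < 1"
  shows "qpinf a q = qpoch a q n * qpinf (a * q ^ n) q"
proof (induction n)
  case (Suc n)
  show ?case
    using qpinf_rec[OF assms, of "a * q ^ n"] Suc by (simp add: qpoch_def mult_ac)
qed (simp add: qpoch_def)

lemma qpinf_0_left [simp]: "qpinf 0 q = 1"
  by (simp add: qpinf_def)

lemma qpoch_Suc: "qpoch a q (Suc n) = qpoch a q n * (1 - a * q ^ n)"
  by (simp add: qpoch_def)

lemma one_minus_qpower_nz:
  fixes q :: complex
  assumes "norm q < 1"
  shows "1 - q * q ^ n \<noteq> 0"
proof
  assume "1 - q * q ^ n = 0"
  hence "norm (q ^ Suc n) = 1" by simp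
  moreover have "norm (q ^ Suc n) < 1"
    using assms power_le_one[of "norm q" n] mult_le_one[of "norm q" "norm q ^ n"]
    by (auto simp: norm_mult norm_power intro: le_less_trans[OF mult_left_le])
  ultimately show False by simp
qed

lemma qpoch_self_nz: "norm q < 1 \<Longrightarrow> qpoch q q n \<noteq> 0"
  using one_minus_qpower_nz by (auto simp: qpoch_def)

text \<open>The tails \<open>qpinf (q * q ^ n) q\<close> tend to \<open>qpinf 0 q = 1\<close>, so
  some tail is nonzero, and the finite head in front of it has no zero factor.\<close>

lemma qpinf_self_nz:
  assumes q: "norm q < 1"
  shows "qpinf q q \<noteq> 0"
proof -
  have "isCont (\<lambda>a. qpinf a q) 0"
    using qpinf_continuous[OF q, of UNIV] by (simp add: continuous_on_eq_continuous_at)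
  moreover have "(\<lambda>n. q * q ^ n) \<longlonglongrightarrow> 0"
    by (intro tendsto_mult_right_zero LIMSEQ_power_zero q)
  ultimately have "(\<lambda>n. qpinf (q * q ^ n) q) \<longlonglongrightarrow> qpinf 0 q"
    by (rule isCont_tendsto_compose)
  hence "\<forall>\<^sub>F n in sequentially. qpinf (q * q ^ n) q \<noteq> 0"
    by (rule tendsto_imp_eventually_ne) simp
  then obtain n where "qpinf (q * q ^ n) q \<noteq> 0"
    by (auto simp: eventually_sequentially)
  thus ?thesis
    using qpinf_eq_qpoch[OF q, of q n] qpoch_self_nz[OF q] by simp
qed

lemma qpoch_LIMSEQ: "norm q < 1 \<Longrightarrow> (\<lambda>n. qpoch a q n) \<longlonglongrightarrow> qpinf a q"
  unfolding qpoch_def by (rule qpinf_LIMSEQ)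

text \<open>The bound is uniform in \<open>n\<close>; it is the domination needed when finite
  symbols are replaced by infinite ones under an average.\<close>

lemma norm_qpoch_le:
  fixes q :: complex
  assumes q: "norm q < 1"
  shows "norm (qpoch a q n) \<le> exp (norm a / (1 - norm q))"
proof -
  have "norm (qpoch a q n) \<le> (\<Prod>k<n. 1 + norm a * norm q ^ k)"
    unfolding qpoch_def prod_norm[symmetric]
    by (intro prod_mono conjI norm_ge_zero order.trans[OF norm_triangle_ineq4])
       (simp add: norm_mult norm_power)
  also have "\<dots> \<le> exp (\<Sum>k<n. norm a * norm q ^ k)"
    by (rule prod_le_exp_sum) auto
  also have "(\<Sum>k<n. norm a * norm q ^ k) \<le> (\<Sum>k. norm a * norm q ^ k)"
    using q by (intro sum_le_suminf summable_mult summable_geometric) auto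
  also have "(\<Sum>k. norm a * norm q ^ k) = norm a / (1 - norm q)"
    using q by (simp add: suminf_mult suminf_geometric summable_geometric)
  finally show ?thesis by simp
qed

section \<open>Circle averages\<close>

definition angle :: "real measure" where
  "angle = restrict_space lborel {0..2 * pi}"

definition circ :: "(complex \<Rightarrow> complex) \<Rightarrow> complex" where
  "circ f = (LINT t|angle. f (cis t)) / complex_of_real (2 * pi)"

lemma finite_measure_angle: "finite_measure angle"
  by (rule finite_measureI) (simp add: angle_def space_restrict_space emeasure_restrict_space)

lemma measure_angle: "measure angle (space angle) = 2 * pi"
  by (simp add: angle_def space_restrict_space measure_restrict_space)

lemma angle_integral: "(LINT t|angle. f t) = (LINT t|lborel. indicator {0..2*pi} t *\<^sub>R f t)"
  for f :: "real \<Rightarrow> complex"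
  unfolding angle_def by (rule integral_restrict_space) auto

lemma circ_const [simp]: "circ (\<lambda>_. c) = c"
  by (simp add: circ_def measure_angle scaleR_conv_of_real)

text \<open>In the coordinate w with t = exp w, a holomorphic function on the punctured plane becomes an
  entire function with period 2 pi i. Its integral over a period is the increment of a primitive,
  and this increment has derivative 0 as a function of the base point.\<close>

lemma circ_shift:
  assumes f: "f holomorphic_on -{0}" and c: "c \<noteq> 0"
  shows "circ (\<lambda>t. f (c * t)) = circ f"
proof -
  define g where "g = (\<lambda>w. f (exp w))"
  have g: "g holomorphic_on UNIV"
    unfolding g_def using holomorphic_on_compose_gen[OF holomorphic_on_exp f, of UNIV]
    by (force simp: o_def)
  obtain P where "\<And>w. w \<in> UNIV \<Longrightarrow> (P has_field_derivative g w) (at w within UNIV)"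
    using holomorphic_convex_primitive'[OF convex_UNIV open_UNIV g] by blast
  hence P: "(P has_field_derivative g w) (at w)" for w
    by simp
  have int: "(LINT t|angle. f (exp L * cis t)) = (P (L + 2 * pi * \<i>) - P L) / \<i>" for L
  proof -
    have "(LINT t|lborel. indicator {0..2*pi} t *\<^sub>R (g (L + of_real t * \<i>)))
       = P (L + of_real (2 * pi) * \<i>) / \<i> - P (L + of_real 0 * \<i>) / \<i>"
    proof (rule integral_FTC_atLeastAtMost)
      fix t :: real
      show "((\<lambda>t. P (L + of_real t * \<i>) / \<i>) has_vector_derivative g (L + of_real t * \<i>))
              (at t within {0..2 * pi})"
        by (rule has_vector_derivative_eq_rhs, rule has_vector_derivative_real_field)
           (auto intro!: derivative_eq_intros DERIV_chain2[OF P] simp: mult.assoc)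
    next
      have "continuous_on UNIV g"
        by (rule holomorphic_on_imp_continuous_on[OF g])
      thus "continuous_on {0..2 * pi} (\<lambda>t. g (L + of_real t * \<i>))"
        by (rule continuous_on_compose2) (auto intro!: continuous_intros)
    qed auto
    thus ?thesis
      by (simp add: angle_integral g_def exp_add cis_conv_exp mult_ac right_diff_distrib)
  qed
  have "\<exists>k. \<forall>L\<in>UNIV. P (L + 2 * pi * \<i>) - P L = k"
  proof (rule has_field_derivative_zero_constant)
    fix L :: complex
    have "((\<lambda>L. P (L + 2 * pi * \<i>) - P L) has_field_derivative (g (L + 2 * pi * \<i>) * 1 - g L)) (at L)"
      by (intro DERIV_diff P DERIV_chain2[OF P]) (auto intro!: derivative_eq_intros)
    moreover have "g (L + 2 * pi * \<i>) = g L"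
      by (simp add: g_def exp_add)
    ultimately show "((\<lambda>L. P (L + 2 * pi * \<i>) - P L) has_field_derivative 0) (at L within UNIV)"
      by simp
  qed auto
  then obtain k where k: "\<And>L. P (L + 2 * pi * \<i>) - P L = k"
    by auto
  show ?thesis
    using int[of "Ln c"] int[of 0] c unfolding circ_def k by simp
qed

text \<open>Scaling by 2 is the test for homogeneity: an average is unchanged by it, while an
  integrand of degree \<open>m\<close> is multiplied by \<open>2 powi m\<close>, so the average
  vanishes unless \<open>m = 0\<close>.\<close>

lemma two_powi_neq_1:
  assumes "m \<noteq> 0"
  shows "(2::complex) powi m \<noteq> 1"
proof
  assume "(2::complex) powi m = 1"
  hence "norm ((2::complex) powi m) = 1" by simp
  hence "(2::real) powi m = 1" by (simp add: norm_power_int)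
  moreover have "(2::real) powi (-m) = inverse (2 powi m)" by (rule power_int_minus)
  ultimately show False
    using assms one_less_power_int[of "2::real" m] one_less_power_int[of "2::real" "-m"]
    by (cases "m > 0") auto
qed

lemma circ_power_int [simp]: "circ (\<lambda>t. t powi m) = (if m = 0 then 1 else 0)"
proof (cases "m = 0")
  case False
  have "(\<lambda>t::complex. t powi m) holomorphic_on -{0}"
    by (intro holomorphic_intros) auto
  hence "circ (\<lambda>t. (2 * t) powi m) = circ (\<lambda>t. t powi m)"
    by (intro circ_shift) auto
  moreover have "circ (\<lambda>t. (2 * t) powi m) = 2 powi m * circ (\<lambda>t. t powi m)"
    by (simp add: circ_def power_int_mult_distrib)
  ultimately show ?thesis
    using False two_powi_neq_1[OF False] by simp
qed auto

interpretation angle: finite_measure angle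
  by (rule finite_measure_angle)

interpretation angles: product_sigma_finite "\<lambda>_. angle"
  by standard

lemma borel_measurable_angle: "f \<in> borel_measurable borel \<Longrightarrow> f \<in> borel_measurable angle"
  unfolding angle_def by (rule measurable_restrict_space1) simp

lemma cis_measurable_angle [measurable]: "cis \<in> borel_measurable angle"
  by (intro borel_measurable_angle borel_measurable_continuous_onI continuous_intros)

section \<open>Torus averages\<close>

definition avg :: "'i set \<Rightarrow> (('i \<Rightarrow> complex) \<Rightarrow> complex) \<Rightarrow> complex" where
  "avg I F = (LINT \<theta>|PiM I (\<lambda>_. angle). F (\<lambda>i. cis (\<theta> i))) / complex_of_real ((2 * pi) ^ card I)"

text \<open>Points are total functions, so that \<open>s(k := w)\<close> can be written freely,
  whereas the space of \<open>PiM\<close> contains only extensional ones. The second clause bridges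
  the two by making coordinates outside \<open>I\<close> irrelevant.\<close>

definition bfun :: "'i set \<Rightarrow> (('i \<Rightarrow> complex) \<Rightarrow> complex) \<Rightarrow> bool" where
  "bfun I F \<longleftrightarrow> F \<in> borel_measurable (PiM I (\<lambda>_. borel)) \<and>
     (\<forall>s s'. (\<forall>i\<in>I. s i = s' i) \<longrightarrow> F s = F s') \<and>
     (\<exists>B. \<forall>s. (\<forall>i. norm (s i) = 1) \<longrightarrow> norm (F s) \<le> B)"

text \<open>A regular function on the product of punctured planes. Contours are moved one variable
  at a time, so separate holomorphy is enough; the bounds on all annuli keep the integrand bounded
  after its arguments have left the unit circles.\<close>

definition torusfn :: "'i set \<Rightarrow> (('i \<Rightarrow> complex) \<Rightarrow> complex) \<Rightarrow> bool" where
  "torusfn I F \<longleftrightarrow> F \<in> borel_measurable (PiM I (\<lambda>_. borel)) \<and>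
     (\<forall>s s'. (\<forall>i\<in>I. s i = s' i) \<longrightarrow> F s = F s') \<and>
     (\<forall>R>0. \<exists>B. \<forall>s. (\<forall>i. 1 / R \<le> norm (s i) \<and> norm (s i) \<le> R) \<longrightarrow> norm (F s) \<le> B) \<and>
     (\<forall>k s. (\<forall>i. s i \<noteq> 0) \<longrightarrow> (\<lambda>w. F (s(k := w))) holomorphic_on -{0})"

lemma bfun_measurable: "bfun I F \<Longrightarrow> F \<in> borel_measurable (PiM I (\<lambda>_. borel))"
  unfolding bfun_def by (rule conjunct1)

lemma bfun_dependence: "bfun I F \<Longrightarrow> (\<And>i. i \<in> I \<Longrightarrow> s i = s' i) \<Longrightarrow> F s = F s'"
  unfolding bfun_def by blast

lemma torusfn_holomorphic:
  "torusfn I F \<Longrightarrow> (\<And>i. s i \<noteq> 0) \<Longrightarrow> (\<lambda>w. F (s(k := w))) holomorphic_on -{0}"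
  unfolding torusfn_def by blast

lemma torusfn_imp_bfun: "torusfn I F \<Longrightarrow> bfun I F"
proof -
  assume F: "torusfn I F"
  then obtain B where "\<forall>s. (\<forall>i. 1 / 1 \<le> norm (s i) \<and> norm (s i) \<le> 1) \<longrightarrow> norm (F s) \<le> B"
    unfolding torusfn_def using zero_less_one by blast
  thus "bfun I F"
    using F unfolding torusfn_def bfun_def by (metis div_by_1 order.refl)
qed

lemma bfun_bounded:
  assumes "bfun I F"
  obtains B where "B \<ge> 0" "\<And>s. (\<And>i. norm (s i) = 1) \<Longrightarrow> norm (F s) \<le> B"
proof -
  from assms obtain B where B: "\<forall>s. (\<forall>i. norm (s i) = 1) \<longrightarrow> norm (F s) \<le> B"
    unfolding bfun_def by blast
  have "norm (F (\<lambda>_. 1)) \<le> B"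
    using B by simp
  hence "B \<ge> 0"
    using norm_ge_zero order.trans by blast
  thus ?thesis
    using B that by blast
qed

lemma bfun_mult:
  assumes "bfun I F" "bfun I G"
  shows "bfun I (\<lambda>s. F s * G s)"
proof -
  obtain A where A: "A \<ge> 0" "\<And>s. (\<And>i. norm (s i) = 1) \<Longrightarrow> norm (F s) \<le> A"
    using bfun_bounded[OF assms(1)] by blast
  obtain B where B: "B \<ge> 0" "\<And>s. (\<And>i. norm (s i) = 1) \<Longrightarrow> norm (G s) \<le> B"
    using bfun_bounded[OF assms(2)] by blast
  have "norm (F s * G s) \<le> A * B" if "\<And>i. norm (s i) = 1" for s
    unfolding norm_mult using A B that by (intro mult_mono) auto
  moreover have "F s * G s = F s' * G s'" if "\<forall>i\<in>I. s i = s' i" for s s'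
    using assms that unfolding bfun_def by metis
  ultimately show ?thesis
    using assms unfolding bfun_def by (auto intro: borel_measurable_times)
qed

lemma bfun_const: "bfun I (\<lambda>_. c)"
  by (auto simp: bfun_def)

lemma bfun_add:
  assumes "bfun I F" "bfun I G"
  shows "bfun I (\<lambda>s. F s + G s)"
proof -
  obtain A where A: "A \<ge> 0" "\<And>s. (\<And>i. norm (s i) = 1) \<Longrightarrow> norm (F s) \<le> A"
    using bfun_bounded[OF assms(1)] by blast
  obtain B where B: "B \<ge> 0" "\<And>s. (\<And>i. norm (s i) = 1) \<Longrightarrow> norm (G s) \<le> B"
    using bfun_bounded[OF assms(2)] by blast
  have "norm (F s + G s) \<le> A + B" if "\<And>i. norm (s i) = 1" for s
    using A(2)[of s] B(2)[of s] that by (intro norm_triangle_mono) auto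
  moreover have "F s + G s = F s' + G s'" if "\<forall>i\<in>I. s i = s' i" for s s'
    using assms that unfolding bfun_def by metis
  ultimately show ?thesis
    using assms unfolding bfun_def by (auto intro: borel_measurable_add)
qed

lemma bfun_sum: "(\<And>j. j \<in> A \<Longrightarrow> bfun I (F j)) \<Longrightarrow> bfun I (\<lambda>s. \<Sum>j\<in>A. F j s)"
  by (induction A rule: infinite_finite_induct) (auto intro: bfun_const bfun_add)

lemma bfun_power: "bfun I F \<Longrightarrow> bfun I (\<lambda>s. F s ^ n)"
  by (induction n) (auto intro: bfun_const bfun_mult)

lemma torusfn_const: "torusfn I (\<lambda>_. c)"
  by (auto simp: torusfn_def)

lemma torusfn_bounded:
  assumes "torusfn I F" "R > 0"
  obtains B where "B \<ge> 0"
    "\<And>s. (\<And>i. 1 / R \<le> norm (s i)) \<Longrightarrow> (\<And>i. norm (s i) \<le> R) \<Longrightarrow> norm (F s) \<le> B"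
proof -
  from assms obtain B where
    "\<forall>s. (\<forall>i. 1 / R \<le> norm (s i) \<and> norm (s i) \<le> R) \<longrightarrow> norm (F s) \<le> B"
    unfolding torusfn_def by blast
  hence "norm (F s) \<le> max 0 B"
    if "\<And>i. 1 / R \<le> norm (s i)" "\<And>i. norm (s i) \<le> R" for s
    using that by (meson max.coboundedI2)
  thus ?thesis
    by (intro that[of "max 0 B"]) auto
qed

lemma torusfn_mult:
  assumes "torusfn I F" "torusfn I G"
  shows "torusfn I (\<lambda>s. F s * G s)"
proof -
  have "\<exists>B. \<forall>s. (\<forall>i. 1 / R \<le> norm (s i) \<and> norm (s i) \<le> R) \<longrightarrow> norm (F s * G s) \<le> B"
    if R: "R > 0" for R
  proof -
    obtain A where A: "A \<ge> 0" "\<And>s. (\<And>i. 1 / R \<le> norm (s i)) \<Longrightarrow> (\<And>i. norm (s i) \<le> R) \<Longrightarrow> norm (F s) \<le> A"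
      using torusfn_bounded[OF assms(1) R] by blast
    obtain B where B: "B \<ge> 0" "\<And>s. (\<And>i. 1 / R \<le> norm (s i)) \<Longrightarrow> (\<And>i. norm (s i) \<le> R) \<Longrightarrow> norm (G s) \<le> B"
      using torusfn_bounded[OF assms(2) R] by blast
    show ?thesis
      unfolding norm_mult using A B by (intro exI[of _ "A * B"] allI impI mult_mono) auto
  qed
  moreover have "F s * G s = F s' * G s'" if "\<forall>i\<in>I. s i = s' i" for s s'
    using assms that unfolding torusfn_def by metis
  ultimately show ?thesis
    using assms unfolding torusfn_def by (auto intro: borel_measurable_times holomorphic_on_mult)
qed

lemma torusfn_add:
  assumes "torusfn I F" "torusfn I G"
  shows "torusfn I (\<lambda>s. F s + G s)"
proof -
  have "\<exists>B. \<forall>s. (\<forall>i. 1 / R \<le> norm (s i) \<and> norm (s i) \<le> R) \<longrightarrow> norm (F s + G s) \<le> B"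
    if R: "R > 0" for R
  proof -
    obtain A where A: "A \<ge> 0" "\<And>s. (\<And>i. 1 / R \<le> norm (s i)) \<Longrightarrow> (\<And>i. norm (s i) \<le> R) \<Longrightarrow> norm (F s) \<le> A"
      using torusfn_bounded[OF assms(1) R] by blast
    obtain B where B: "B \<ge> 0" "\<And>s. (\<And>i. 1 / R \<le> norm (s i)) \<Longrightarrow> (\<And>i. norm (s i) \<le> R) \<Longrightarrow> norm (G s) \<le> B"
      using torusfn_bounded[OF assms(2) R] by blast
    show ?thesis
      using A B by (intro exI[of _ "A + B"] allI impI norm_triangle_mono) auto
  qed
  moreover have "F s + G s = F s' + G s'" if "\<forall>i\<in>I. s i = s' i" for s s'
    using assms that unfolding torusfn_def by metis
  ultimately show ?thesis
    using assms unfolding torusfn_def by (auto intro: borel_measurable_add holomorphic_on_add)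
qed

lemma torusfn_cmult: "torusfn I F \<Longrightarrow> torusfn I (\<lambda>s. c * F s)"
  by (intro torusfn_mult torusfn_const)

lemma torusfn_diff: 
  assumes "torusfn I F" "torusfn I G"
  shows "torusfn I (\<lambda>s. F s - G s)"
  using torusfn_add[OF assms(1) torusfn_cmult[OF assms(2), of "-1"]] by simp

lemma torusfn_sum: "(\<And>j. j \<in> A \<Longrightarrow> torusfn I (F j)) \<Longrightarrow> torusfn I (\<lambda>s. \<Sum>j\<in>A. F j s)"
  by (induction A rule: infinite_finite_induct) (auto intro: torusfn_const torusfn_add)

lemma torusfn_prod: "(\<And>j. j \<in> A \<Longrightarrow> torusfn I (F j)) \<Longrightarrow> torusfn I (\<lambda>s. \<Prod>j\<in>A. F j s)"
  by (induction A rule: infinite_finite_induct) (auto intro: torusfn_const torusfn_mult)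

lemma torusfn_power: "torusfn I F \<Longrightarrow> torusfn I (\<lambda>s. F s ^ n)"
  by (induction n) (auto intro: torusfn_const torusfn_mult)

lemma torusfn_coord:
  assumes "i \<in> I"
  shows "torusfn I (\<lambda>s. s i)"
proof -
  have "(\<lambda>w. (s(k := w)) i) holomorphic_on - {0}" for k and s :: "'a \<Rightarrow> complex"
    by (cases "k = i") auto
  thus ?thesis
    using assms unfolding torusfn_def by (auto intro: measurable_component_singleton)
qed

lemma torusfn_inverse_coord:
  assumes "i \<in> I"
  shows "torusfn I (\<lambda>s. inverse (s i))"
proof -
  have "(\<lambda>w. inverse ((s(k := w)) i)) holomorphic_on - {0}" for k and s :: "'a \<Rightarrow> complex"
    by (cases "k = i") (auto intro: holomorphic_on_inverse)
  moreover have "norm (inverse (s i)) \<le> R" if "1 / R \<le> norm (s i)" "R > 0" for R and s :: "'a \<Rightarrow> complex"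
  proof -
    have "inverse (norm (s i)) \<le> inverse (1 / R)"
      using that by (intro le_imp_inverse_le) auto
    thus ?thesis by (simp add: norm_inverse)
  qed
  ultimately show ?thesis
    using assms unfolding torusfn_def
    by (intro conjI allI impI borel_measurable_inverse measurable_component_singleton) metis+
qed

lemma torusfn_divide_coord: "i \<in> I \<Longrightarrow> torusfn I F \<Longrightarrow> torusfn I (\<lambda>s. F s / s i)"
  unfolding divide_inverse by (intro torusfn_mult torusfn_inverse_coord)

lemma torusfn_power_int_coord: "i \<in> I \<Longrightarrow> torusfn I (\<lambda>s. s i powi m)"
  by (cases "m \<ge> 0")
     (auto simp: power_int_def intro: torusfn_power torusfn_coord torusfn_inverse_coord)

lemma torusfn_qpinf:
  assumes q: "norm q < 1" and F: "torusfn I F"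
  shows "torusfn I (\<lambda>s. qpinf (F s) q)"
proof -
  have "\<exists>B. \<forall>s. (\<forall>i. 1 / R \<le> norm (s i) \<and> norm (s i) \<le> R) \<longrightarrow> norm (qpinf (F s) q) \<le> B"
    if R: "R > 0" for R
  proof -
    obtain A where A: "\<And>s. (\<And>i. 1 / R \<le> norm (s i)) \<Longrightarrow> (\<And>i. norm (s i) \<le> R) \<Longrightarrow> norm (F s) \<le> A"
      using torusfn_bounded[OF F R] by blast
    obtain C where C: "\<And>a. norm a \<le> A \<Longrightarrow> norm (qpinf a q) \<le> C"
      using qpinf_bounded[OF q] by blast
    show ?thesis
      using A C by (intro exI[of _ C]) auto
  qed
  moreover have "qpinf (F s) q = qpinf (F s') q" if "\<forall>i\<in>I. s i = s' i" for s s'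
    using F that unfolding torusfn_def by metis
  moreover have "(\<lambda>w. qpinf (F (s(k := w))) q) holomorphic_on - {0}" if "\<forall>i. s i \<noteq> 0" for s k
    using that F holomorphic_on_compose[OF _ qpinf_holomorphic[OF q], of "\<lambda>w. F (s(k := w))" "-{0}"]
    unfolding torusfn_def by (auto simp: o_def)
  moreover have "(\<lambda>s. qpinf (F s) q) \<in> borel_measurable (PiM I (\<lambda>_. borel))"
    using F unfolding torusfn_def by (intro measurable_compose[OF _ qpinf_measurable[OF q]]) auto
  ultimately show ?thesis
    unfolding torusfn_def by auto
qed

lemmas torusfn_intros =
  torusfn_const torusfn_mult torusfn_add torusfn_diff torusfn_sum torusfn_prod torusfn_power
  torusfn_coord torusfn_inverse_coord torusfn_divide_coord torusfn_power_int_coord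

text \<open>The substituted coordinates stay in the annulus given by \<open>R\<close>, where
  \<open>torusfn\<close> provides a bound. The conclusion is only \<open>bfun\<close> because the
  \<open>g i\<close> are not assumed to be holomorphic.\<close>

lemma torusfn_compose_bfun:
  assumes F: "torusfn I F" and R: "R \<ge> 1"
    and g: "\<And>i. i \<in> I \<Longrightarrow> bfun I (g i)"
    and gR: "\<And>i s. i \<in> I \<Longrightarrow> (\<And>j. norm (s j) = 1) \<Longrightarrow> 1 / R \<le> norm (g i s) \<and> norm (g i s) \<le> R"
  shows "bfun I (\<lambda>s. F (\<lambda>i. g i s))"
proof -
  have dep: "F s = F s'" if "\<And>i. i \<in> I \<Longrightarrow> s i = s' i" for s s'
    using F that unfolding torusfn_def by blast
  have meas: "(\<lambda>s. \<lambda>i\<in>I. g i s) \<in> measurable (PiM I (\<lambda>_. borel)) (PiM I (\<lambda>_. borel))"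
    using g unfolding bfun_def by (intro measurable_restrict) auto
  have "(\<lambda>s. F (\<lambda>i\<in>I. g i s)) \<in> borel_measurable (PiM I (\<lambda>_. borel))"
    using F unfolding torusfn_def by (intro measurable_compose[OF meas]) auto
  also have "(\<lambda>s. F (\<lambda>i\<in>I. g i s)) = (\<lambda>s. F (\<lambda>i. g i s))"
    by (intro ext dep) auto
  finally have 1: "(\<lambda>s. F (\<lambda>i. g i s)) \<in> borel_measurable (PiM I (\<lambda>_. borel))" .
  have 2: "F (\<lambda>i. g i s) = F (\<lambda>i. g i s')" if "\<forall>i\<in>I. s i = s' i" for s s'
    using g that unfolding bfun_def by (intro dep) blast
  have 3: "\<exists>B. \<forall>s. (\<forall>i. norm (s i) = 1) \<longrightarrow> norm (F (\<lambda>i. g i s)) \<le> B"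
  proof -
    obtain B where B: "\<And>s. (\<And>i. 1 / R \<le> norm (s i)) \<Longrightarrow> (\<And>i. norm (s i) \<le> R) \<Longrightarrow> norm (F s) \<le> B"
      using torusfn_bounded[OF F, of R] R by (metis less_le_trans zero_less_one)
    have "norm (F (\<lambda>i. g i s)) \<le> B" if s: "\<forall>i. norm (s i) = 1" for s
    proof -
      \<comment> \<open>Outside \<open>I\<close> nothing is known about \<open>g i s\<close>; the
        value 1 lies in every such annulus and does not change \<open>F\<close>.\<close>
      have "F (\<lambda>i. g i s) = F (\<lambda>i. if i \<in> I then g i s else 1)"
        by (rule dep) auto
      also have "norm \<dots> \<le> B"
        using gR s R by (intro B) auto
      finally show ?thesis .
    qed
    thus ?thesis by blast
  qed
  show ?thesis
    unfolding bfun_def using 1 2 3 by blast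
qed

lemma finite_measure_angles: "finite I \<Longrightarrow> finite_measure (PiM I (\<lambda>_. angle))"
proof (rule finite_measureI)
  assume I: "finite I"
  have "emeasure (PiM I (\<lambda>_. angle)) (PiE I (\<lambda>_. space angle)) = (\<Prod>i\<in>I. emeasure angle (space angle))"
    using I by (rule angles.emeasure_PiM) auto
  also have "\<dots> \<noteq> \<infinity>"
    using I by (subst infinity_ennreal_def, subst ennreal_prod_eq_top) (auto simp: angle.emeasure_finite)
  finally show "emeasure (PiM I (\<lambda>_. angle)) (space (PiM I (\<lambda>_. angle))) \<noteq> \<infinity>"
    by (simp add: space_PiM)
qed

lemma bfun_measurable_angles:
  assumes "bfun I F"
  shows "(\<lambda>\<theta>. F (\<lambda>i. cis (\<theta> i))) \<in> borel_measurable (PiM I (\<lambda>_. angle))"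
proof -
  have "(\<lambda>\<theta>. \<lambda>i\<in>I. cis (\<theta> i)) \<in> measurable (PiM I (\<lambda>_. angle)) (PiM I (\<lambda>_. borel))"
    by (intro measurable_restrict measurable_compose[OF _ cis_measurable_angle] measurable_component_singleton)
  hence "(\<lambda>\<theta>. F (\<lambda>i\<in>I. cis (\<theta> i))) \<in> borel_measurable (PiM I (\<lambda>_. angle))"
    by (rule measurable_compose[OF _ bfun_measurable[OF assms]])
  also have "(\<lambda>\<theta>. F (\<lambda>i\<in>I. cis (\<theta> i))) = (\<lambda>\<theta>. F (\<lambda>i. cis (\<theta> i)))"
  proof
    fix \<theta> :: "'a \<Rightarrow> real"
    show "F (\<lambda>i\<in>I. cis (\<theta> i)) = F (\<lambda>i. cis (\<theta> i))"
      by (rule bfun_dependence[OF assms]) simp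
  qed
  finally show ?thesis .
qed

lemma bfun_integrable:
  assumes "finite I" "bfun I F"
  shows "integrable (PiM I (\<lambda>_. angle)) (\<lambda>\<theta>. F (\<lambda>i. cis (\<theta> i)))"
proof -
  obtain B where B: "B \<ge> 0" "\<And>s. (\<And>i. norm (s i) = 1) \<Longrightarrow> norm (F s) \<le> B"
    using bfun_bounded[OF assms(2)] by blast
  have "norm (F (\<lambda>i. cis (\<theta> i))) \<le> B" for \<theta>
    by (rule B(2)) simp
  thus ?thesis
    by (intro finite_measure.integrable_const_bound[OF finite_measure_angles[OF assms(1)], of _ B]
          bfun_measurable_angles assms) simp
qed

lemma measure_angles: "finite I \<Longrightarrow> measure (PiM I (\<lambda>_. angle)) (space (PiM I (\<lambda>_. angle))) = (2 * pi) ^ card I"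
proof -
  assume I: "finite I"
  have "emeasure (PiM I (\<lambda>_. angle)) (PiE I (\<lambda>_. space angle)) = (\<Prod>i\<in>I. emeasure angle (space angle))"
    using I by (rule angles.emeasure_PiM) auto
  also have "\<dots> = ennreal ((2 * pi) ^ card I)"
    by (simp add: angle.emeasure_eq_measure measure_angle ennreal_power)
  finally show ?thesis
    by (simp add: measure_def space_PiM)
qed

lemma avg_const [simp]: "finite I \<Longrightarrow> avg I (\<lambda>_. c) = c"
  by (simp add: avg_def measure_angles scaleR_conv_of_real)

lemma avg_cong:
  assumes "\<And>s. (\<And>i. norm (s i) = 1) \<Longrightarrow> F s = G s"
  shows "avg I F = avg I G"
  unfolding avg_def by (subst assms) auto

lemma avg_add:
  assumes "finite I" "bfun I F" "bfun I G"
  shows "avg I (\<lambda>s. F s + G s) = avg I F + avg I G"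
  unfolding avg_def by (subst Bochner_Integration.integral_add) (use assms in \<open>auto intro: bfun_integrable simp: add_divide_distrib\<close>)

lemma avg_cmult: "avg I (\<lambda>s. c * F s) = c * avg I F"
  unfolding avg_def by simp

lemma avg_diff:
  assumes "finite I" "bfun I F" "bfun I G"
  shows "avg I (\<lambda>s. F s - G s) = avg I F - avg I G"
  unfolding avg_def by (subst Bochner_Integration.integral_diff) (use assms in \<open>auto intro: bfun_integrable simp: diff_divide_distrib\<close>)

lemma avg_sum:
  assumes "finite I" "\<And>j. j \<in> A \<Longrightarrow> bfun I (F j)"
  shows "avg I (\<lambda>s. \<Sum>j\<in>A. F j s) = (\<Sum>j\<in>A. avg I (F j))"
  unfolding avg_def by (subst Bochner_Integration.integral_sum) (use assms in \<open>auto intro: bfun_integrable simp: sum_divide_distrib\<close>)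

lemma norm_avg_le:
  assumes "finite I" "bfun I F" "\<And>s. (\<And>i. norm (s i) = 1) \<Longrightarrow> norm (F s) \<le> B"
  shows "norm (avg I F) \<le> B"
proof -
  interpret finite_measure "PiM I (\<lambda>_. angle)"
    by (rule finite_measure_angles[OF assms(1)])
  have "norm (LINT \<theta>|PiM I (\<lambda>_. angle). F (\<lambda>i. cis (\<theta> i))) \<le>
        (LINT \<theta>|PiM I (\<lambda>_. angle). norm (F (\<lambda>i. cis (\<theta> i))))"
    by (rule integral_norm_bound)
  also have "\<dots> \<le> (LINT \<theta>|PiM I (\<lambda>_. angle). B)"
    by (intro integral_mono integrable_norm bfun_integrable assms) auto
  also have "\<dots> = (2 * pi) ^ card I * B"
    using measure_angles[OF assms(1)] by simp
  finally show ?thesis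
    by (simp add: avg_def norm_divide norm_power norm_mult field_simps)
qed

lemma avg_insert:
  assumes I: "finite I" "k \<notin> I" and F: "bfun (insert k I) F"
  shows "avg (insert k I) F = avg I (\<lambda>s. circ (\<lambda>w. F (s(k := w))))"
proof -
  have *: "(\<lambda>i. cis ((x(k := y)) i)) = (\<lambda>i. cis (x i))(k := cis y)" for x y
    by auto
  have "(LINT \<theta>|PiM (insert k I) (\<lambda>_. angle). F (\<lambda>i. cis (\<theta> i))) =
        (LINT \<theta>|PiM I (\<lambda>_. angle). LINT t|angle. F ((\<lambda>i. cis (\<theta> i))(k := cis t)))"
    using angles.product_integral_insert[OF I bfun_integrable[OF _ F]] I unfolding * by simp
  thus ?thesis
    using I unfolding avg_def circ_def by simp
qed

text \<open>By Fubini the variable \<open>k\<close> is integrated first; \<open>c s\<close> ignores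
  it and hence is a constant there, which \<open>circ_shift\<close> removes. Factors that vary with
  the other variables are what the passage to the product of all variables requires.\<close>

lemma avg_shift:
  assumes I: "finite I" "k \<in> I" and F: "bfun I F" and Fc: "bfun I (\<lambda>s. F (s(k := c s * s k)))"
    and hol: "\<And>s. (\<And>i. norm (s i) = 1) \<Longrightarrow> (\<lambda>w. F (s(k := w))) holomorphic_on -{0}"
    and c: "\<And>s w. c (s(k := w)) = c s" "\<And>s. (\<And>i. norm (s i) = 1) \<Longrightarrow> c s \<noteq> 0"
  shows "avg I (\<lambda>s. F (s(k := c s * s k))) = avg I F"
proof -
  define J where "J = I - {k}"
  have J: "finite J" "k \<notin> J" "I = insert k J"
    using I by (auto simp: J_def)
  have "avg I (\<lambda>s. F (s(k := c s * s k))) = avg J (\<lambda>s. circ (\<lambda>w. F (s(k := c s * w))))"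
    unfolding J(3) using Fc J c(1) by (subst avg_insert) simp_all
  also have "\<dots> = avg J (\<lambda>s. circ (\<lambda>w. F (s(k := w))))"
    by (intro avg_cong circ_shift[of "\<lambda>w. F (_(k := w))"] hol c(2)) auto
  also have "\<dots> = avg I F"
    unfolding J(3) using F J by (subst avg_insert) simp_all
  finally show ?thesis .
qed

lemma avg_unused:
  assumes J: "finite J" "k \<notin> J" and F: "bfun J F"
  shows "avg (insert k J) F = avg J F"
proof -
  have dep: "F s = F s'" if "\<forall>i\<in>J. s i = s' i" for s s'
    using bfun_dependence[OF F] that by blast
  have "(\<lambda>s. F (\<lambda>i\<in>J. s i)) \<in> borel_measurable (PiM (insert k J) (\<lambda>_. borel))"
    by (intro measurable_compose[OF _ bfun_measurable[OF F]] measurable_restrict_subset) auto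
  also have "(\<lambda>s. F (\<lambda>i\<in>J. s i)) = F"
    by (intro ext dep) auto
  finally have "F \<in> borel_measurable (PiM (insert k J) (\<lambda>_. borel))" .
  hence "bfun (insert k J) F"
    using F dep unfolding bfun_def by (metis (no_types, lifting) insertCI)
  hence "avg (insert k J) F = avg J (\<lambda>s. circ (\<lambda>w. F (s(k := w))))"
    by (intro avg_insert J)
  also have "(\<lambda>s. circ (\<lambda>w. F (s(k := w)))) = (\<lambda>s. circ (\<lambda>_. F s))"
  proof
    fix s
    have "(\<lambda>w. F (s(k := w))) = (\<lambda>_. F s)"
      using J by (intro ext dep) auto
    thus "circ (\<lambda>w. F (s(k := w))) = circ (\<lambda>_. F s)"
      by simp
  qed
  finally show ?thesis by simp
qed

text \<open>The coordinates in \<open>J\<close> are scaled one at a time. As \<open>c\<close>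
  ignores all of them, its value survives the earlier scalings, and \<open>R\<close> confines the
  partly scaled points to an annulus on which \<open>F\<close> is bounded.\<close>

lemma avg_scale:
  assumes F: "torusfn I F" and I: "finite I" and J: "J \<subseteq> I"
    and R: "R \<ge> 1" and c: "bfun I c"
    and cR: "\<And>s. (\<And>j. norm (s j) = 1) \<Longrightarrow> 1 / R \<le> norm (c s) \<and> norm (c s) \<le> R"
    and c_indep: "\<And>s i w. i \<in> J \<Longrightarrow> c (s(i := w)) = c s"
  shows "avg I (\<lambda>s. F (\<lambda>i. if i \<in> J then c s * s i else s i)) = avg I F"
proof -
  have "finite J"
    using I J finite_subset by blast
  have bf: "bfun I (\<lambda>s. F (\<lambda>i. if i \<in> J' then c s * s i else s i))" for J'
  proof (rule torusfn_compose_bfun[OF F R])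
    show "bfun I (\<lambda>s. if i \<in> J' then c s * s i else s i)" if "i \<in> I" for i
      using that by (cases "i \<in> J'") (auto intro!: bfun_mult c torusfn_imp_bfun[OF torusfn_coord])
    show "1 / R \<le> norm (if i \<in> J' then c s * s i else s i) \<and> norm (if i \<in> J' then c s * s i else s i) \<le> R"
      if "\<And>j. norm (s j) = 1" for s i
      using cR[of s] R that by (auto simp: norm_mult)
  qed
  show ?thesis
    using \<open>finite J\<close> J c_indep
  proof (induction J rule: finite_induct)
    case (insert k J)
    let ?F = "\<lambda>s. F (\<lambda>i. if i \<in> J then c s * s i else s i)"
    have eq: "?F (s(k := c s * s k)) = F (\<lambda>i. if i \<in> insert k J then c s * s i else s i)" for s
      unfolding insert.prems(2)[OF insertI1] using insert.hyps by (intro arg_cong[of _ _ F] ext) auto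
    have "avg I (\<lambda>s. ?F (s(k := c s * s k))) = avg I ?F"
    proof (rule avg_shift)
      show "bfun I (\<lambda>s. ?F (s(k := c s * s k)))"
        unfolding eq by (rule bf)
      fix s :: "'a \<Rightarrow> complex"
      assume s: "\<And>i. norm (s i) = 1"
      show "c s \<noteq> 0"
        using cR[of s] s R by auto
      let ?t = "\<lambda>i. if i \<in> J then c s * s i else s i"
      have "(\<lambda>w. F (?t(k := w))) holomorphic_on -{0}"
      proof (rule torusfn_holomorphic[OF F])
      have "s i \<noteq> 0" for i
        using s[of i] by auto
      thus "?t i \<noteq> 0" for i
        using \<open>c s \<noteq> 0\<close> by simp
    qed
      also have "(\<lambda>w. F (?t(k := w))) = (\<lambda>w. ?F (s(k := w)))"
        unfolding insert.prems(2)[OF insertI1] using insert.hyps by (intro ext arg_cong[of _ _ F]) auto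
      finally show "(\<lambda>w. ?F (s(k := w))) holomorphic_on -{0}" .
    qed (use insert.prems I bf in auto)
    thus ?case
      unfolding eq using insert by simp
  qed simp
qed

text \<open>A finite geometric sum leaves a remainder equal to \<open>c ^ M\<close> times the
  average of a function bounded independently of \<open>M\<close>, because \<open>u\<close> has
  modulus 1 on the torus. No interchange of an infinite sum with the integral is required.\<close>

lemma avg_geometric:
  assumes I: "finite I" and F: "bfun I F" and u: "bfun I u" and c: "norm c < 1"
    and u1: "\<And>s. (\<And>i. norm (s i) = 1) \<Longrightarrow> norm (u s) = 1"
  shows "(\<lambda>n. c ^ n * avg I (\<lambda>s. F s * u s ^ n)) sums avg I (\<lambda>s. F s / (1 - c * u s))"
    and "bfun I (\<lambda>s. F s / (1 - c * u s))"
proof -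
  have lower: "1 - norm c \<le> norm (1 - c * u s)" if "\<And>i. norm (s i) = 1" for s
    using norm_triangle_ineq2[of 1 "c * u s"] u1[of s] that by (simp add: norm_mult)
  have inv: "bfun I (\<lambda>s. inverse (1 - c * u s))"
    unfolding bfun_def
  proof (intro conjI)
    show "(\<lambda>s. inverse (1 - c * u s)) \<in> borel_measurable (PiM I (\<lambda>_. borel))"
      using u unfolding bfun_def by (auto intro!: borel_measurable_inverse borel_measurable_diff borel_measurable_times)
    show "\<forall>s s'. (\<forall>i\<in>I. s i = s' i) \<longrightarrow> inverse (1 - c * u s) = inverse (1 - c * u s')"
      using u unfolding bfun_def by metis
    have "norm (inverse (1 - c * u s)) \<le> inverse (1 - norm c)" if "\<forall>i. norm (s i) = 1" for s
      unfolding norm_inverse using lower[of s] that c by (intro le_imp_inverse_le) auto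
    thus "\<exists>B. \<forall>s. (\<forall>i. norm (s i) = 1) \<longrightarrow> norm (inverse (1 - c * u s)) \<le> B"
      by blast
  qed
  show bf: "bfun I (\<lambda>s. F s / (1 - c * u s))"
    unfolding divide_inverse by (intro bfun_mult F inv)
  obtain B where B: "B \<ge> 0" "\<And>s. (\<And>i. norm (s i) = 1) \<Longrightarrow> norm (F s / (1 - c * u s)) \<le> B"
    using bfun_bounded[OF bf] by blast
  let ?A = "avg I (\<lambda>s. F s / (1 - c * u s))"
  have rem: "norm (?A - (\<Sum>n<M. c ^ n * avg I (\<lambda>s. F s * u s ^ n))) \<le> B * norm c ^ M" for M
  proof -
    have "avg I (\<lambda>s. F s / (1 - c * u s)) =
          avg I (\<lambda>s. (\<Sum>n<M. c ^ n * (F s * u s ^ n)) + c ^ M * (F s / (1 - c * u s) * u s ^ M))"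
    proof (rule avg_cong)
      fix s :: "'a \<Rightarrow> complex"
      assume s: "\<And>i. norm (s i) = 1"
      have nz: "1 - c * u s \<noteq> 0"
        using lower[of s] s c by auto
      have "(\<Sum>n<M. c ^ n * (F s * u s ^ n)) = F s * (\<Sum>n<M. (c * u s) ^ n)"
        by (simp add: sum_distrib_left power_mult_distrib mult_ac)
      also have "(\<Sum>n<M. (c * u s) ^ n) = (1 - (c * u s) ^ M) / (1 - c * u s)"
        using nz by (subst sum_gp_strict) auto
      finally show "F s / (1 - c * u s) =
          (\<Sum>n<M. c ^ n * (F s * u s ^ n)) + c ^ M * (F s / (1 - c * u s) * u s ^ M)"
        using nz by (simp add: divide_simps power_mult_distrib) (simp add: algebra_simps)
    qed
    also have "\<dots> = (\<Sum>n<M. c ^ n * avg I (\<lambda>s. F s * u s ^ n)) +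
                    c ^ M * avg I (\<lambda>s. F s / (1 - c * u s) * u s ^ M)"
      by (subst avg_add avg_sum avg_cmult; (intro I bfun_sum bfun_mult bfun_const bfun_power F u bf)?)+ simp
    finally have "norm (?A - (\<Sum>n<M. c ^ n * avg I (\<lambda>s. F s * u s ^ n))) =
        norm c ^ M * norm (avg I (\<lambda>s. F s / (1 - c * u s) * u s ^ M))"
      by (simp add: norm_mult norm_power)
    also have "\<dots> \<le> norm c ^ M * B"
    proof (rule mult_left_mono)
      show "norm (avg I (\<lambda>s. F s / (1 - c * u s) * u s ^ M)) \<le> B"
        using B u1 by (intro norm_avg_le I bfun_mult bf bfun_power u) (simp add: norm_mult norm_power norm_divide)
    qed auto
    finally show ?thesis
      by (simp add: mult.commute)
  qed
  have "(\<lambda>M. ?A - (\<Sum>n<M. c ^ n * avg I (\<lambda>s. F s * u s ^ n))) \<longlonglongrightarrow> 0"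
  proof (rule Lim_null_comparison)
    show "\<forall>\<^sub>F M in sequentially. norm (?A - (\<Sum>n<M. c ^ n * avg I (\<lambda>s. F s * u s ^ n))) \<le> B * norm c ^ M"
      using rem by simp
    show "(\<lambda>M. B * norm c ^ M) \<longlonglongrightarrow> 0"
      using c by (intro tendsto_mult_right_zero LIMSEQ_power_zero) auto
  qed
  hence "(\<lambda>M. ?A - (?A - (\<Sum>n<M. c ^ n * avg I (\<lambda>s. F s * u s ^ n)))) \<longlonglongrightarrow> ?A - 0"
    by (intro tendsto_diff tendsto_const)
  thus "(\<lambda>n. c ^ n * avg I (\<lambda>s. F s * u s ^ n)) sums avg I (\<lambda>s. F s / (1 - c * u s))"
    by (simp add: sums_def)
qed

section \<open>Cauchy's formula on an annulus and Laurent expansion along a subtorus\<close>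

lemma circ_integrable:
  fixes f :: "complex \<Rightarrow> complex"
  assumes "continuous_on (sphere 0 1) f"
  shows "integrable angle (\<lambda>t. f (cis t))"
proof -
  have "continuous_on UNIV (\<lambda>t. f (cis t))"
    by (rule continuous_on_compose2[OF assms]) (auto intro!: continuous_intros)
  hence meas: "(\<lambda>t. f (cis t)) \<in> borel_measurable angle"
    by (intro borel_measurable_angle borel_measurable_continuous_onI)
  have "compact (f ` sphere 0 1)"
    by (intro compact_continuous_image assms) auto
  then obtain B where "\<forall>x\<in>f ` sphere 0 1. norm x \<le> B"
    using compact_imp_bounded bounded_iff by blast
  hence "AE t in angle. norm (f (cis t)) \<le> B"
    by auto
  thus ?thesis
    using meas by (rule angle.integrable_const_bound)
qed

lemma circ_add:
  assumes "continuous_on (sphere 0 1) f" "continuous_on (sphere 0 1) g"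
  shows "circ (\<lambda>t. f t + g t) = circ f + circ g"
  unfolding circ_def using assms
  by (subst Bochner_Integration.integral_add) (auto intro: circ_integrable simp: add_divide_distrib)

lemma circ_diff:
  assumes "continuous_on (sphere 0 1) f" "continuous_on (sphere 0 1) g"
  shows "circ (\<lambda>t. f t - g t) = circ f - circ g"
  unfolding circ_def using assms
  by (subst Bochner_Integration.integral_diff) (auto intro: circ_integrable simp: diff_divide_distrib)

lemma circ_cmult: "circ (\<lambda>t. c * f t) = c * circ f"
  by (simp add: circ_def)

lemma circ_cong: "(\<And>t. norm t = 1 \<Longrightarrow> f t = g t) \<Longrightarrow> circ f = circ g"
  by (simp add: circ_def)

text \<open>A circle is a torus with index type \<open>unit\<close>; in this form
  \<open>avg_geometric\<close> applies to it.\<close>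

lemma circ_eq_avg:
  assumes "f \<in> borel_measurable borel"
  shows "circ f = avg {()} (\<lambda>s. f (s ()))"
proof -
  have "(\<lambda>t. f (cis t)) \<in> borel_measurable angle"
    by (rule measurable_compose[OF cis_measurable_angle assms])
  from angles.product_integral_singleton[OF this, of "()"] show ?thesis
    by (simp add: circ_def avg_def)
qed

lemma borel_measurable_power_int:
  "(\<lambda>t::complex. t powi m) \<in> borel_measurable borel"
  by (cases "m \<ge> 0") (auto simp: power_int_def)

text \<open>In the geometric expansion every power of \<open>t\<close> except the constant one
  averages to 0.\<close>

lemma circ_geometric:
  fixes c :: complex and m :: int
  assumes c: "norm c < 1" and m: "m \<noteq> 0"
  shows "circ (\<lambda>t. 1 / (1 - c * t powi m)) = 1"
proof -
  have "(\<lambda>n. c ^ n * avg {()} (\<lambda>s. 1 * (s () powi m) ^ n)) sums avg {()} (\<lambda>s. 1 / (1 - c * s () powi m))"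
    by (rule avg_geometric)
       (auto intro!: bfun_const torusfn_imp_bfun[OF torusfn_power_int_coord] c simp: norm_power_int)
  moreover have "avg {()} (\<lambda>s. 1 * (s () powi m) ^ n) = circ (\<lambda>t. t powi (m * int n))" for n
    by (subst circ_eq_avg) (auto simp: borel_measurable_power_int power_int_mult intro!: borel_measurable_power)
  moreover have "(\<lambda>n. c ^ n * circ (\<lambda>t. t powi (m * int n))) = (\<lambda>n. if n = 0 then 1 else 0)"
    using m by auto
  moreover have "avg {()} (\<lambda>s. 1 / (1 - c * s () powi m)) = circ (\<lambda>t. 1 / (1 - c * t powi m))"
    by (subst circ_eq_avg)
       (auto intro!: borel_measurable_divide borel_measurable_diff borel_measurable_times borel_measurable_power_int)
  ultimately have "(\<lambda>n. if n = 0 then 1 else 0) sums circ (\<lambda>t. 1 / (1 - c * t powi m))"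
    by simp
  moreover have "(\<lambda>n::nat. if n = 0 then 1 else 0) sums (1::complex)"
    using sums_single[of 0 "\<lambda>_. 1::complex"] by simp
  ultimately show ?thesis
    by (rule sums_unique2)
qed

text \<open>Cauchy's formula at 1 for the annulus between the circles of radius 2 and 1/2, with the
  integration variable rescaled to the unit circle.\<close>

lemma annulus_formula:
  assumes f: "f holomorphic_on -{0}"
  shows "f 1 = circ (\<lambda>t. f (2 * t) / (1 - 1/2 * inverse t) + f (1/2 * t) * (t / 2) / (1 - 1/2 * t))"
proof -
  \<comment> \<open>The difference quotient of \<open>f\<close> at 1 has a removable singularity,
    and the factor \<open>t\<close> converts the angular measure into \<open>dt\<close>. Hence
    \<open>g\<close> has the same average on the circles of radius 2 and 1/2.\<close>
  define g where "g = (\<lambda>t. t * (if t = 1 then deriv f 1 else (f t - f 1) / (t - 1)))"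
  have g: "g holomorphic_on -{0}"
    unfolding g_def by (intro holomorphic_intros pole_lemma_open f) auto
  have half: "norm (1/2 * t) = 1/2" "norm (1/2 * inverse t) = 1/2" "t \<noteq> 0" if "norm t = 1" for t :: complex
    using that by (auto simp: norm_mult norm_inverse)
  have nz: "1 - 1/2 * t \<noteq> 0" "1 - 1/2 * inverse t \<noteq> 0" "2 * t \<noteq> 1" "t \<noteq> 2" "t \<noteq> 0" if "norm t = 1" for t :: complex
    using half[OF that] that by (auto simp: field_simps)
  have cont: "continuous_on (sphere 0 1) (\<lambda>t. f (c * t))" if "c \<noteq> 0" for c
    by (rule continuous_on_compose2[OF holomorphic_on_imp_continuous_on[OF f]])
       (use that in \<open>auto intro!: continuous_intros\<close>)
  note [continuous_intros] = cont
  have "0 = circ (\<lambda>t. g (2 * t)) - circ (\<lambda>t. g (1/2 * t))"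
    using circ_shift[OF g, of 2] circ_shift[OF g, of "1/2"] by simp
  also have "circ (\<lambda>t. g (2 * t)) =
      circ (\<lambda>t. f (2 * t) / (1 - 1/2 * inverse t) - f 1 * (1 / (1 - 1/2 * t powi (-1))))"
  proof (rule circ_cong)
    fix t :: complex
    assume t: "norm t = 1"
    have eq: "1 - 1/2 * inverse t = (2 * t - 1) / (2 * t)"
      using nz[OF t] by (simp add: field_simps)
    show "g (2 * t) = f (2 * t) / (1 - 1/2 * inverse t) - f 1 * (1 / (1 - 1/2 * t powi (-1)))"
      unfolding power_int_minus power_int_1_right eq using nz(3)[OF t]
      by (simp add: g_def right_diff_distrib mult_ac flip: diff_divide_distrib)
  qed
  also have "\<dots> = circ (\<lambda>t. f (2 * t) / (1 - 1/2 * inverse t)) - f 1"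
    by (subst circ_diff, (intro continuous_intros; use nz in \<open>auto simp: power_int_minus\<close>)+)
       (subst circ_cmult, subst circ_geometric, auto)
  \<comment> \<open>On the inner circle the kernel is the geometric one minus 1, with average 0, so
    \<open>f 1\<close> drops out here; on the outer circle it survives with coefficient 1.\<close>
  also have "circ (\<lambda>t. g (1/2 * t)) =
      circ (\<lambda>t. (f 1 * (1 / (1 - 1/2 * t powi 1)) - f 1) - f (1/2 * t) * (t / 2) / (1 - 1/2 * t))"
  proof (rule circ_cong)
    fix t :: complex
    assume t: "norm t = 1"
    have "f 1 * (1 / (1 - 1/2 * t)) - f 1 = f 1 * (t / 2) / (1 - 1/2 * t)"
      using nz(1)[OF t] by (simp add: field_simps)
    moreover have "g (1/2 * t) = (1/2 * t) * (f (1/2 * t) - f 1) / (1/2 * t - 1)"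
      using nz(4)[OF t] by (simp add: g_def)
    moreover have "\<dots> = (f 1 - f (1/2 * t)) * (t / 2) / (1 - 1/2 * t)"
      by (subst minus_divide_divide[symmetric]) (simp add: algebra_simps)
    ultimately show "g (1/2 * t) = (f 1 * (1 / (1 - 1/2 * t powi 1)) - f 1) - f (1/2 * t) * (t / 2) / (1 - 1/2 * t)"
      by (simp only: power_int_1_right diff_divide_distrib left_diff_distrib)
  qed
  also have "\<dots> = - circ (\<lambda>t. f (1/2 * t) * (t / 2) / (1 - 1/2 * t))"
    by (subst circ_diff circ_cmult, (intro continuous_intros; use nz in \<open>auto\<close>)+)+
       (subst circ_cmult, subst circ_geometric, auto)
  finally have "f 1 = circ (\<lambda>t. f (2 * t) / (1 - 1/2 * inverse t)) +
                  circ (\<lambda>t. f (1/2 * t) * (t / 2) / (1 - 1/2 * t))"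
    by (simp add: algebra_simps)
  also have "\<dots> = circ (\<lambda>t. f (2 * t) / (1 - 1/2 * inverse t) + f (1/2 * t) * (t / 2) / (1 - 1/2 * t))"
    by (subst circ_add, (intro continuous_intros; use nz in \<open>auto\<close>)+) auto
  finally show ?thesis .
qed

lemma prod_power_int:
  fixes s :: "'i \<Rightarrow> complex"
  shows "(\<Prod>i\<in>A. s i) powi m = (\<Prod>i\<in>A. s i powi m)"
proof -
  have "(\<Prod>i\<in>A. s i) ^ n = (\<Prod>i\<in>A. s i ^ n)" for n
    by (rule prod_power_distrib)
  moreover have "inverse (\<Prod>i\<in>A. s i) ^ n = (\<Prod>i\<in>A. inverse (s i) ^ n)" for n
    unfolding prod_inversef[symmetric] o_def by (rule prod_power_distrib)
  ultimately show ?thesis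
    by (cases "m \<ge> 0") (simp_all add: power_int_def)
qed

lemma torusfn_power_int_prod: "A \<subseteq> I \<Longrightarrow> torusfn I (\<lambda>s. (\<Prod>i\<in>A. s i) powi m)"
  unfolding prod_power_int by (auto intro!: torusfn_intros)

lemma torus_nonzero: "(\<And>i. norm (s i) = 1) \<Longrightarrow> s i \<noteq> (0 :: complex)"
  by (metis norm_zero zero_neq_one)

lemma norm_prod_torus: "(\<And>i. norm (s i) = 1) \<Longrightarrow> norm (\<Prod>i\<in>J. s i :: complex) = 1"
  by (simp add: prod_norm[symmetric])

text \<open>With the other variables fixed, F is a function of the product of all variables; the subtorus
  average is the value at 1 of its Laurent series, whose coefficients are averages over the full torus.\<close>

lemma avg_subtorus:
  fixes F :: "('i \<Rightarrow> complex) \<Rightarrow> complex"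
  assumes F: "torusfn (insert l J) F" and J: "finite J" "l \<notin> J"
  defines "a \<equiv> \<lambda>n. avg (insert l J) (\<lambda>s. F s * (\<Prod>i\<in>insert l J. s i) powi (-n))"
  obtains S1 S2 where "(\<lambda>n. a (int n)) sums S1" "(\<lambda>n. a (- int (Suc n))) sums S2"
    "avg J (\<lambda>s. F (s(l := inverse (\<Prod>i\<in>J. s i)))) = S1 + S2"
proof -
  define I where "I = insert l J"
  have I: "finite I" "l \<in> I" "J \<subseteq> I"
    using J by (auto simp: I_def)
  define P where "P = (\<lambda>s::'i \<Rightarrow> complex. \<Prod>i\<in>J. s i)"
  \<comment> \<open>Where \<open>P s\<close> is nonzero, this substitution makes the product of all
    variables equal to \<open>c * s l\<close>, so that \<open>s l\<close> becomes the Laurent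
    variable on a circle of radius \<open>norm c\<close>.\<close>
  define G where "G = (\<lambda>c s. F (s(l := c * inverse (P s) * s l)))"
  have P1: "norm (P s) = 1" if "\<And>i. norm (s i) = 1" for s
    unfolding P_def using that by (rule norm_prod_torus)
  have P_upd: "P (s(l := w)) = P s" for s w
    unfolding P_def using J by (intro prod.cong) auto
  have torusP: "torusfn I (\<lambda>s. inverse (P s))"
    using torusfn_power_int_prod[OF I(3), of "-1"] by (simp add: power_int_minus P_def)
  have G_bfun: "bfun I (G c)" if c: "1/2 \<le> norm c" "norm c \<le> 2" for c
  proof -
    have "bfun I (\<lambda>s. F (\<lambda>i. if i = l then c * inverse (P s) * s l else s i))"
    proof (rule torusfn_compose_bfun[OF F[folded I_def], of 2])
      show "bfun I (\<lambda>s. if i = l then c * inverse (P s) * s l else s i)" if "i \<in> I" for i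
        using that I by (cases "i = l") (auto intro!: torusfn_imp_bfun torusfn_intros torusP)
      show "1 / 2 \<le> norm (if i = l then c * inverse (P s) * s l else s i) \<and>
            norm (if i = l then c * inverse (P s) * s l else s i) \<le> 2" if "\<And>j. norm (s j) = 1" for i s
        using that P1[of s] c by (simp add: norm_mult norm_inverse)
    qed auto
    moreover have "(\<lambda>i. if i = l then c * inverse (P s) * s l else s i) = s(l := c * inverse (P s) * s l)" for s
      by auto
    ultimately show ?thesis
      by (simp add: G_def)
  qed
  have a_eq: "a n = avg I (\<lambda>s. G c s * (c * s l) powi (-n))" if c: "1/2 \<le> norm c" "norm c \<le> 2" for c n
  proof -
    define H where "H = (\<lambda>s. F s * (\<Prod>i\<in>I. s i) powi (-n))"
    have H: "torusfn I H"
      unfolding H_def using F by (intro torusfn_intros torusfn_power_int_prod) (auto simp: I_def)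
    have nz: "P s \<noteq> 0" "s l \<noteq> 0" if "\<And>i. norm (s i) = 1" for s
      using P1[of s] torus_nonzero[of s l] that by auto
    have "(\<Prod>i\<in>I. (s(l := c * inverse (P s) * s l)) i) = c * inverse (P s) * s l * P (s(l := c * inverse (P s) * s l))" for s
      using J by (simp add: I_def P_def)
    \<comment> \<open>This form is needed at every point, since \<open>bfun\<close> includes
      measurability, and \<open>P s\<close> may vanish off the torus; the cancellation of
      \<open>inverse (P s) * P s\<close> is therefore left to \<open>eq'\<close>, on the
      torus.\<close>
    hence eq: "H (s(l := c * inverse (P s) * s l)) = G c s * (c * inverse (P s) * P s * s l) powi (-n)" for s
      unfolding P_upd by (simp add: H_def G_def mult_ac)
    have eq': "H (s(l := c * inverse (P s) * s l)) = G c s * (c * s l) powi (-n)" if "\<And>i. norm (s i) = 1" for s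
      unfolding eq using nz(1)[of s] that by (simp add: mult.assoc)
    have "avg I (\<lambda>s. H (s(l := c * inverse (P s) * s l))) = avg I H"
    proof (rule avg_shift)
      show "bfun I (\<lambda>s. H (s(l := c * inverse (P s) * s l)))"
        unfolding eq
      proof (intro bfun_mult G_bfun c)
        have "bfun I (\<lambda>s. c powi (-n) * (inverse (P s) * P s) powi (-n) * s l powi (-n))"
          using I by (auto intro!: torusfn_imp_bfun torusfn_intros torusP torusfn_power_int_prod
              simp: power_int_mult_distrib P_def power_int_inverse power_int_minus[symmetric] 
              simp del: power_int_minus)
        thus "bfun I (\<lambda>s. (c * inverse (P s) * P s * s l) powi (-n))"
          by (simp only: power_int_mult_distrib mult_ac)
      qed
      fix s :: "'i \<Rightarrow> complex" and w
      show "c * inverse (P (s(l := w))) = c * inverse (P s)"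
        by (simp only: P_upd)
      assume s: "\<And>i. norm (s i) = 1"
      show "(\<lambda>w. H (s(l := w))) holomorphic_on -{0}"
        by (intro torusfn_holomorphic[OF H] torus_nonzero s)
      show "c * inverse (P s) \<noteq> 0"
        using nz(1)[of s] s c by auto
    qed (use I torusfn_imp_bfun[OF H] in auto)
    also have "avg I (\<lambda>s. H (s(l := c * inverse (P s) * s l))) = avg I (\<lambda>s. G c s * (c * s l) powi (-n))"
      by (rule avg_cong) (rule eq')
    finally show ?thesis
      by (simp add: a_def H_def I_def)
  qed
  have G2: "bfun I (G 2)" "bfun I (\<lambda>s. inverse (s l))"
    "bfun I (\<lambda>s. G (1/2) s * (s l / 2))" "bfun I (\<lambda>s. s l)"
  proof -
    show l: "bfun I (\<lambda>s. s l)" and "bfun I (\<lambda>s. inverse (s l))"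
      using I by (intro torusfn_imp_bfun torusfn_intros; simp)+
    have "bfun I (\<lambda>s. G (1/2) s * (s l * (1/2)))"
      by (intro bfun_mult G_bfun l bfun_const) auto
    thus "bfun I (\<lambda>s. G (1/2) s * (s l / 2))"
      by simp
  qed (rule G_bfun; simp)
  have half: "norm (1/2 :: complex) < 1"
    by simp
  \<comment> \<open>The circle of radius 2 produces the coefficients with nonnegative index, the
    circle of radius 1/2 the negative ones. Each is a contour for the same \<open>a n\<close> by
    \<open>a_eq\<close>.\<close>
  have 1: "(\<lambda>n. (1/2) ^ n * avg I (\<lambda>s. G 2 s * inverse (s l) ^ n)) sums
             avg I (\<lambda>s. G 2 s / (1 - 1/2 * inverse (s l)))"
          "bfun I (\<lambda>s. G 2 s / (1 - 1/2 * inverse (s l)))"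
    by (rule avg_geometric[OF I(1) G2(1,2) half]; simp add: norm_inverse)+
  have 2: "(\<lambda>n. (1/2) ^ n * avg I (\<lambda>s. G (1/2) s * (s l / 2) * s l ^ n)) sums
             avg I (\<lambda>s. G (1/2) s * (s l / 2) / (1 - 1/2 * s l))"
          "bfun I (\<lambda>s. G (1/2) s * (s l / 2) / (1 - 1/2 * s l))"
    by (rule avg_geometric[OF I(1) G2(3,4) half]; simp)+
  have t1: "(1/2) ^ n * avg I (\<lambda>s. G 2 s * inverse (s l) ^ n) = a (int n)" for n
    unfolding a_eq[of 2, simplified] avg_cmult[symmetric]
    by (rule arg_cong[of _ _ "avg I"])
       (auto simp: fun_eq_iff power_int_minus power_mult_distrib field_simps)
  \<comment> \<open>The factor \<open>s l / 2\<close> in front of the inner kernel makes the powers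
    start at 1, hence \<open>- int (Suc n)\<close>.\<close>
  have t2: "(1/2) ^ n * avg I (\<lambda>s. G (1/2) s * (s l / 2) * s l ^ n) = a (- int (Suc n))" for n
    unfolding a_eq[of "1/2", simplified] avg_cmult[symmetric] minus_minus power_int_of_nat
    by (rule arg_cong[of _ _ "avg I"])
       (auto simp: fun_eq_iff power_mult_distrib field_simps)
  have "avg J (\<lambda>s. F (s(l := inverse (P s)))) =
        avg J (\<lambda>s. circ (\<lambda>t. G 2 (s(l := t)) / (1 - 1/2 * inverse ((s(l := t)) l)) +
          G (1/2) (s(l := t)) * ((s(l := t)) l / 2) / (1 - 1/2 * (s(l := t)) l)))"
  proof (rule avg_cong)
    fix s :: "'i \<Rightarrow> complex"
    assume s: "\<And>i. norm (s i) = 1"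
    have nz: "s i \<noteq> 0" for i
      using s[of i] by auto
    \<comment> \<open>In the composed function \<open>w\<close> is the product of all variables, and
      the subtorus is the point \<open>w = 1\<close>.\<close>
    have "(\<lambda>w. F (s(l := w))) \<circ> (\<lambda>w. w * inverse (P s)) holomorphic_on -{0}"
      by (intro holomorphic_on_compose_gen[OF _ torusfn_holomorphic[OF F nz]] holomorphic_intros)
         (use P1[of s] s in auto)
    from annulus_formula[OF this]
    show "F (s(l := inverse (P s))) = circ (\<lambda>t. G 2 (s(l := t)) / (1 - 1/2 * inverse ((s(l := t)) l)) +
          G (1/2) (s(l := t)) * ((s(l := t)) l / 2) / (1 - 1/2 * (s(l := t)) l))"
      by (simp add: G_def P_upd mult_ac)
  qed
  also have "\<dots> = avg I (\<lambda>s. G 2 s / (1 - 1/2 * inverse (s l)) + G (1/2) s * (s l / 2) / (1 - 1/2 * s l))"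
    unfolding I_def by (rule avg_insert[symmetric]) (use J bfun_add[OF 1(2) 2(2)] in \<open>auto simp: I_def\<close>)
  also have "\<dots> = avg I (\<lambda>s. G 2 s / (1 - 1/2 * inverse (s l))) + avg I (\<lambda>s. G (1/2) s * (s l / 2) / (1 - 1/2 * s l))"
    by (rule avg_add) (use I 1 2 in auto)
  finally show ?thesis
    using 1(1) 2(1) that unfolding t1 t2 P_def by blast
qed

section \<open>Partial fraction identities\<close>

text \<open>As polynomials in \<open>z\<close>, \<open>P + M\<close> and \<open>Q\<close> have
  degree at most \<open>N\<close> and the same coefficient there, so agreement at the
  \<open>N\<close> nodes \<open>1 / s k\<close> suffices. The monomial \<open>M\<close> supplies the
  top term of \<open>Q\<close>, which is out of reach for \<open>P\<close>.\<close>

lemma lagrange_sum: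
  fixes s :: "'i \<Rightarrow> complex"
  assumes I: "finite I" "I \<noteq> {}" and inj: "inj_on s I" and nz: "\<And>i. i \<in> I \<Longrightarrow> s i \<noteq> 0"
  shows "(\<Sum>k\<in>I. (\<Prod>i\<in>I-{k}. 1 - z * s i) / (\<Prod>j\<in>I-{k}. 1 - s k / s j)) =
         (\<Prod>i\<in>I. 1 - z * s i) - (- z) ^ card I * (\<Prod>i\<in>I. s i)"
proof -
  define N where "N = card I"
  define c where "c = (\<lambda>k. 1 / (\<Prod>j\<in>I-{k}. 1 - s k / s j))"
  define M where "M = monom ((-1) ^ N * (\<Prod>i\<in>I. s i)) N"
  define P where "P = (\<Sum>k\<in>I. smult (c k) (\<Prod>i\<in>I-{k}. [:1, - s i:]))"
  define Q where "Q = (\<Prod>i\<in>I. [:1, - s i:])"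
  have N: "N > 0"
    using I by (auto simp: N_def card_gt_0_iff)
  have degP: "degree P \<le> N - 1"
    unfolding P_def
  proof (intro degree_sum_le order.trans[OF degree_smult_le] I)
    fix k assume k: "k \<in> I"
    have "degree (\<Prod>i\<in>I-{k}. [:1, - s i:]) \<le> (\<Sum>i\<in>I-{k}. degree [:1, - s i:])"
      using I by (intro degree_prod_sum_le[unfolded o_def]) auto
    also have "\<dots> \<le> (\<Sum>i\<in>I-{k}. 1)"
      by (intro sum_mono) auto
    also have "\<dots> = N - 1"
      using k I by (simp add: N_def)
    finally show "degree (\<Prod>i\<in>I-{k}. [:1, - s i:]) \<le> N - 1" .
  qed
  have degQ: "degree Q = N"
    unfolding Q_def using nz by (subst degree_prod_eq_sum_degree) (auto simp: N_def)
  have "coeff Q N = (\<Prod>i\<in>I. lead_coeff [:1, - s i:])"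
    unfolding degQ[symmetric] unfolding Q_def by (rule lead_coeff_prod)
  also have "\<dots> = (\<Prod>i\<in>I. - s i)"
    using nz by (intro prod.cong) auto
  also have "\<dots> = (-1) ^ N * (\<Prod>i\<in>I. s i)"
    by (simp add: prod_uminus N_def)
  finally have coeffQ: "coeff Q N = (-1) ^ N * (\<Prod>i\<in>I. s i)" .
  have "P + M = Q"
  proof (rule poly_eqI_degree_lead_coeff[of _ N _ "(\<lambda>k. 1 / s k) ` I"])
    have "coeff P N = 0"
      using degP N by (intro coeff_eq_0) auto
    thus "coeff (P + M) N = coeff Q N"
      by (simp add: coeffQ M_def)
    have "inj_on (\<lambda>k. 1 / s k) I"
      using inj by (auto simp: inj_on_def)
    thus "N \<le> card ((\<lambda>k. 1 / s k) ` I)"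
      by (simp add: card_image N_def)
    show "degree (P + M) \<le> N"
      using degP degree_monom_le unfolding M_def by (intro degree_add_le) auto
    show "degree Q \<le> N"
      by (simp add: degQ)
    fix y assume "y \<in> (\<lambda>k. 1 / s k) ` I"
    then obtain k where k: "k \<in> I" "y = 1 / s k"
      by auto
    have "poly P y = (\<Sum>l\<in>I. c l * (\<Prod>i\<in>I-{l}. 1 - y * s i))"
      by (simp add: P_def poly_sum poly_prod)
    \<comment> \<open>Every summand with \<open>l\<close> different from \<open>k\<close> contains
      the factor \<open>1 - y * s k\<close>, which is 0 at this node.\<close>
    also have "\<dots> = (\<Sum>l\<in>I. if l = k then c k * (\<Prod>i\<in>I-{k}. 1 - y * s i) else 0)"
      using k I nz[OF k(1)] by (intro sum.cong) (auto intro!: prod_zero bexI[of _ k])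
    also have "\<dots> = c k * (\<Prod>i\<in>I-{k}. 1 - s i / s k)"
      using k I by simp
    also have "(\<Prod>i\<in>I-{k}. 1 - s i / s k) = (\<Prod>i\<in>I-{k}. (- s i / s k) * (1 - s k / s i))"
      using nz k by (intro prod.cong) (auto simp: divide_simps)
    also have "\<dots> = (\<Prod>i\<in>I-{k}. - s i / s k) * (\<Prod>i\<in>I-{k}. 1 - s k / s i)"
      by (rule prod.distrib)
    also have "c k * \<dots> = (\<Prod>i\<in>I-{k}. - s i / s k)"
    proof -
      have "s k / s i \<noteq> 1" if "i \<in> I - {k}" for i
        using that inj k nz[of i] by (auto simp: inj_on_def)
      hence "(\<Prod>i\<in>I-{k}. 1 - s k / s i) \<noteq> 0"
        using I by auto
      thus ?thesis by (simp add: c_def)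
    qed
    \<comment> \<open>Including the index \<open>k\<close> adds the factor
      \<open>- s k / s k\<close>, that is -1.\<close>
    also have "\<dots> = - (\<Prod>i\<in>I. - s i / s k)"
      using I k nz[OF k(1)] by (subst (2) prod.remove[of _ k]) auto
    also have "(\<Prod>i\<in>I. - s i / s k) = (\<Prod>i\<in>I. - s i) / s k ^ N"
      unfolding prod_dividef by (simp add: N_def)
    also have "(\<Prod>i\<in>I. - s i) = (-1) ^ N * (\<Prod>i\<in>I. s i)"
      by (simp add: prod_uminus N_def)
    finally have "poly P y = - poly M y"
      by (simp add: M_def poly_monom k power_divide)
    moreover have "poly Q y = 0"
      using k I nz by (auto simp: Q_def poly_prod)
    ultimately show "poly (P + M) y = poly Q y"
      by simp
  qed
  hence "poly P z = poly Q z - poly M z"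
    by (metis add_diff_cancel_right' poly_add)
  thus ?thesis
    by (simp add: P_def Q_def M_def c_def poly_sum poly_prod poly_monom N_def power_minus[of z] mult_ac)
qed

text \<open>Both follow from \<open>lagrange_sum\<close> for the reciprocals of the variables. The
  first is its value at \<open>z = 0\<close>. The second is the first-order term as \<open>z\<close>
  tends to infinity: with \<open>y = 1 / z\<close> it compares two expressions for the derivative of
  \<open>p\<close> at 0.\<close>

lemma lagrange_sum_inverse:
  fixes s :: "'i \<Rightarrow> complex"
  assumes I: "finite I" "I \<noteq> {}" and inj: "inj_on s I" and nz: "\<And>i. i \<in> I \<Longrightarrow> s i \<noteq> 0"
  shows "(\<Sum>k\<in>I. 1 / (\<Prod>j\<in>I-{k}. 1 - s j / s k)) = 1"
    and "(\<Sum>k\<in>I. s k / (\<Prod>j\<in>I-{k}. 1 - s j / s k)) = (\<Sum>k\<in>I. s k)"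
proof -
  define c where "c = (\<lambda>k. 1 / (\<Prod>j\<in>I-{k}. 1 - s j / s k))"
  have N: "card I > 0"
    using I by (auto simp: card_gt_0_iff)
  have "inj_on (\<lambda>i. inverse (s i)) I"
    using inj by (auto simp: inj_on_def)
  hence L: "(\<Sum>k\<in>I. (\<Prod>i\<in>I-{k}. 1 - z * inverse (s i)) * c k) =
         (\<Prod>i\<in>I. 1 - z * inverse (s i)) - (- z) ^ card I * (\<Prod>i\<in>I. inverse (s i))" for z
    using lagrange_sum[OF I, of "\<lambda>i. inverse (s i)" z] nz
    by (simp add: c_def divide_inverse mult.commute)
  show "(\<Sum>k\<in>I. 1 / (\<Prod>j\<in>I-{k}. 1 - s j / s k)) = 1"
    using L[of 0] N by (simp add: c_def)
  define p where "p = (\<lambda>y. \<Prod>i\<in>I. 1 - y * s i)"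
  \<comment> \<open>The reciprocal identity at \<open>1 / y\<close>, multiplied by the product of
    the \<open>- y * s i\<close>; its top-degree term becomes the constant 1, which is
    \<open>p 0\<close>.\<close>
  have eq: "(p (0 + y) - p 0) / y = - (\<Sum>k\<in>I. c k * s k * (\<Prod>i\<in>I-{k}. 1 - y * s i))" if y: "y \<noteq> 0" for y
  proof -
    have fac: "(1 - inverse y * inverse (s i)) * (- y * s i) = 1 - y * s i" if "i \<in> I" for i
      using nz[OF that] y by (simp add: field_simps)
    have "(\<Sum>k\<in>I. c k * (- y * s k) * (\<Prod>i\<in>I-{k}. 1 - y * s i)) =
          (\<Sum>k\<in>I. (\<Prod>i\<in>I-{k}. 1 - inverse y * inverse (s i)) * c k * (\<Prod>i\<in>I. - y * s i))"
    proof (rule sum.cong)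
      fix k assume k: "k \<in> I"
      have "(\<Prod>i\<in>I-{k}. 1 - y * s i) = (\<Prod>i\<in>I-{k}. (1 - inverse y * inverse (s i)) * (- y * s i))"
        by (rule prod.cong) (use fac in auto)
      also have "\<dots> = (\<Prod>i\<in>I-{k}. 1 - inverse y * inverse (s i)) * (\<Prod>i\<in>I-{k}. - y * s i)"
        by (rule prod.distrib)
      finally show "c k * (- y * s k) * (\<Prod>i\<in>I-{k}. 1 - y * s i) =
           (\<Prod>i\<in>I-{k}. 1 - inverse y * inverse (s i)) * c k * (\<Prod>i\<in>I. - y * s i)"
        using k I prod.remove[of I k "\<lambda>i. - y * s i"] by simp
    qed auto
    also have "\<dots> = ((\<Prod>i\<in>I. 1 - inverse y * inverse (s i)) -
        (- inverse y) ^ card I * (\<Prod>i\<in>I. inverse (s i))) * (\<Prod>i\<in>I. - y * s i)"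
      unfolding L[symmetric] by (rule sum_distrib_right[symmetric])
    also have "\<dots> = (\<Prod>i\<in>I. (1 - inverse y * inverse (s i)) * (- y * s i)) -
        (\<Prod>i\<in>I. (- inverse y) * inverse (s i) * (- y * s i))"
      by (simp only: prod.distrib prod_constant) (rule left_diff_distrib)
    also have "(\<Prod>i\<in>I. (1 - inverse y * inverse (s i)) * (- y * s i)) = p y"
      unfolding p_def by (rule prod.cong) (use fac in auto)
    also have "(\<Prod>i\<in>I. (- inverse y) * inverse (s i) * (- y * s i)) = (\<Prod>i\<in>I. 1)"
      using y nz by (intro prod.cong) (auto simp: field_simps)
    finally have "p y - 1 = - y * (\<Sum>k\<in>I. c k * s k * (\<Prod>i\<in>I-{k}. 1 - y * s i))"
      by (simp add: sum_distrib_left mult_ac sum_negf)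
    thus ?thesis
      using y by (simp add: p_def)
  qed
  have "(p has_field_derivative (\<Sum>i\<in>I. - s i * (\<Prod>j\<in>I-{i}. 1 - 0 * s j))) (at 0)"
    unfolding p_def by (rule has_field_derivative_prod) (auto intro!: derivative_eq_intros)
  hence "((\<lambda>y. (p (0 + y) - p 0) / y) \<longlongrightarrow> - (\<Sum>k\<in>I. s k)) (at 0)"
    by (simp add: DERIV_def sum_negf)
  moreover have "((\<lambda>y. (p (0 + y) - p 0) / y) \<longlongrightarrow> - (\<Sum>k\<in>I. c k * s k * (\<Prod>i\<in>I-{k}. 1 - 0 * s i))) (at 0)"
  proof (rule Lim_transform_eventually)
    show "((\<lambda>y. - (\<Sum>k\<in>I. c k * s k * (\<Prod>i\<in>I-{k}. 1 - y * s i))) \<longlongrightarrow>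
        - (\<Sum>k\<in>I. c k * s k * (\<Prod>i\<in>I-{k}. 1 - 0 * s i))) (at 0)"
      by (intro tendsto_intros)
    show "\<forall>\<^sub>F y in at 0. - (\<Sum>k\<in>I. c k * s k * (\<Prod>i\<in>I-{k}. 1 - y * s i)) = (p (0 + y) - p 0) / y"
      unfolding eventually_at_filter using eq by (intro always_eventually) auto
  qed
  ultimately have "- (\<Sum>k\<in>I. s k) = - (\<Sum>k\<in>I. c k * s k * (\<Prod>i\<in>I-{k}. 1 - 0 * s i))"
    using tendsto_unique[OF trivial_limit_at] by blast
  thus "(\<Sum>k\<in>I. s k / (\<Prod>j\<in>I-{k}. 1 - s j / s k)) = (\<Sum>k\<in>I. s k)"
    by (simp add: c_def)
qed

section \<open>The vector multiplet weight\<close>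

definition weyl :: "complex \<Rightarrow> 'i set \<Rightarrow> ('i \<Rightarrow> complex) \<Rightarrow> complex" where
  "weyl q I s = (\<Prod>i\<in>I. \<Prod>j\<in>I-{i}. qpinf (s i / s j) q)"

text \<open>The weight without the factors \<open>1 - s k / s j\<close>; \<open>weyl_down\<close>
  below lacks the factors \<open>1 - s j / s k\<close> instead. Inserting \<open>q\<close> in the
  argument avoids a quotient, so the functions stay regular where variables collide.\<close>

definition weyl_up :: "complex \<Rightarrow> 'i set \<Rightarrow> 'i \<Rightarrow> ('i \<Rightarrow> complex) \<Rightarrow> complex" where
  "weyl_up q I k s = (\<Prod>i\<in>I. \<Prod>j\<in>I-{i}. qpinf ((if i = k then q else 1) * (s i / s j)) q)"

definition weyl_down :: "complex \<Rightarrow> 'i set \<Rightarrow> 'i \<Rightarrow> ('i \<Rightarrow> complex) \<Rightarrow> complex" where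
  "weyl_down q I k s = (\<Prod>i\<in>I. \<Prod>j\<in>I-{i}. qpinf ((if j = k then q else 1) * (s i / s j)) q)"

lemma qpinf_split:
  "norm q < 1 \<Longrightarrow> qpinf a q = qpinf ((if b then q else 1) * a) q * (if b then 1 - a else 1)"
  using qpinf_rec[of q a] by (cases b) (simp_all only: if_True if_False mult.commute mult_1_left mult_1_right)

lemma weyl_conv_up:
  assumes q: "norm q < 1" and I: "finite I" "k \<in> I"
  shows "weyl q I s = weyl_up q I k s * (\<Prod>j\<in>I-{k}. 1 - s k / s j)"
proof -
  have "weyl q I s = (\<Prod>i\<in>I. \<Prod>j\<in>I-{i}. qpinf ((if i = k then q else 1) * (s i / s j)) q *
          (if i = k then 1 - s i / s j else 1))"
    unfolding weyl_def by (intro prod.cong refl qpinf_split q)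
  also have "\<dots> = weyl_up q I k s * (\<Prod>i\<in>I. \<Prod>j\<in>I-{i}. if i = k then 1 - s i / s j else 1)"
    by (simp add: weyl_up_def prod.distrib)
  also have "(\<Prod>i\<in>I. \<Prod>j\<in>I-{i}. if i = k then 1 - s i / s j else 1) =
             (\<Prod>i\<in>I. if i = k then \<Prod>j\<in>I-{k}. 1 - s k / s j else 1)"
    by (intro prod.cong) auto
  also have "\<dots> = (\<Prod>j\<in>I-{k}. 1 - s k / s j)"
    using I by simp
  finally show ?thesis .
qed

lemma weyl_conv_down:
  assumes q: "norm q < 1" and I: "finite I" "k \<in> I"
  shows "weyl q I s = weyl_down q I k s * (\<Prod>j\<in>I-{k}. 1 - s j / s k)"
proof -
  have "weyl q I s = (\<Prod>i\<in>I. \<Prod>j\<in>I-{i}. qpinf ((if j = k then q else 1) * (s i / s j)) q *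
          (if j = k then 1 - s i / s j else 1))"
    unfolding weyl_def by (intro prod.cong refl qpinf_split q)
  also have "\<dots> = weyl_down q I k s * (\<Prod>i\<in>I. \<Prod>j\<in>I-{i}. if j = k then 1 - s i / s j else 1)"
    by (simp add: weyl_down_def prod.distrib)
  also have "(\<Prod>i\<in>I. \<Prod>j\<in>I-{i}. if j = k then 1 - s i / s j else 1) =
             (\<Prod>i\<in>I. if i = k then 1 else 1 - s i / s k)"
  proof (rule prod.cong[OF refl])
    fix i assume "i \<in> I"
    have "(\<Prod>j\<in>I-{i}. if j = k then 1 - s i / s j else 1) = (if k \<in> I - {i} then 1 - s i / s k else 1)"
      using I by (intro prod.delta) auto
    thus "(\<Prod>j\<in>I-{i}. if j = k then 1 - s i / s j else 1) = (if i = k then 1 else 1 - s i / s k)"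
      using I by auto
  qed
  also have "\<dots> = (\<Prod>j\<in>I-{k}. 1 - s j / s k)"
    using I by (subst prod.remove[of _ k]) (auto intro!: prod.cong)
  finally show ?thesis .
qed

lemma qpinf_1: "norm q < 1 \<Longrightarrow> qpinf 1 q = 0"
  by (subst qpinf_rec) auto

text \<open>Only factors 1 - s i / s j with a common index are removed from the weight, so one of
  the two factors that vanish at s a = s b survives. Hence no distinctness is needed below.\<close>

lemma weyl_coincident:
  assumes q: "norm q < 1" and I: "finite I" and ab: "a \<in> I" "b \<in> I" "a \<noteq> b" "s a = s b" "s a \<noteq> 0"
  shows "weyl q I s = 0" "weyl_up q I k s = 0" "weyl_down q I k s = 0"
proof -
  have z: "(\<Prod>i\<in>I. \<Prod>j\<in>I-{i}. f i j) = 0" if "f a b = 0 \<or> f b a = 0" for f :: "'a \<Rightarrow> 'a \<Rightarrow> complex"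
  proof -
    have "\<exists>i\<in>I. \<exists>j\<in>I-{i}. f i j = 0"
      using that ab by auto
    hence "\<exists>i\<in>I. (\<Prod>j\<in>I-{i}. f i j) = 0"
      using I by (auto intro: prod_zero)
    thus ?thesis
      using I by (intro prod_zero)
  qed
  show "weyl q I s = 0" "weyl_up q I k s = 0" "weyl_down q I k s = 0"
    unfolding weyl_def weyl_up_def weyl_down_def using ab qpinf_1[OF q]
    by (intro z; auto)+
qed

lemma weyl_up_sum:
  assumes q: "norm q < 1" and I: "finite I" "I \<noteq> {}" and nz: "\<And>i. i \<in> I \<Longrightarrow> s i \<noteq> 0"
  shows "(\<Sum>k\<in>I. weyl_up q I k s * (\<Prod>i\<in>I-{k}. 1 - z * s i)) =
         weyl q I s * ((\<Prod>i\<in>I. 1 - z * s i) - (- z) ^ card I * (\<Prod>i\<in>I. s i))"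
proof (cases "inj_on s I")
  case True
  have "weyl_up q I k s = weyl q I s / (\<Prod>j\<in>I-{k}. 1 - s k / s j)" if k: "k \<in> I" for k
  proof -
    have "s k / s i \<noteq> 1" if "i \<in> I - {k}" for i
      using that True k nz[of i] by (auto simp: inj_on_def)
    hence "(\<Prod>i\<in>I-{k}. 1 - s k / s i) \<noteq> 0"
      using I by auto
    thus ?thesis
      using weyl_conv_up[OF q I(1) k, of s] by simp
  qed
  hence "(\<Sum>k\<in>I. weyl_up q I k s * (\<Prod>i\<in>I-{k}. 1 - z * s i)) =
    (\<Sum>k\<in>I. weyl q I s * ((\<Prod>i\<in>I-{k}. 1 - z * s i) / (\<Prod>j\<in>I-{k}. 1 - s k / s j)))"
    by (intro sum.cong) auto
  also have "\<dots> = weyl q I s * ((\<Prod>i\<in>I. 1 - z * s i) - (- z) ^ card I * (\<Prod>i\<in>I. s i))"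
    unfolding sum_distrib_left[symmetric] by (subst lagrange_sum[OF I True nz]) auto
  finally show ?thesis .
next
  case False
  then obtain a b where "a \<in> I" "b \<in> I" "a \<noteq> b" "s a = s b"
    by (auto simp: inj_on_def)
  thus ?thesis
    using weyl_coincident[OF q I(1), of a b s] nz by simp
qed

text \<open>With \<open>A = 1\<close> and \<open>B = 0\<close> it splits the weight into pieces
  attached to single variables; a nonzero \<open>B\<close> brings in the sum of the variables, which
  is the Wilson line insertion.\<close>

lemma weyl_down_sum:
  assumes q: "norm q < 1" and I: "finite I" "I \<noteq> {}" and nz: "\<And>i. i \<in> I \<Longrightarrow> s i \<noteq> 0"
  shows "(\<Sum>k\<in>I. weyl_down q I k s * (A + B * s k)) = weyl q I s * (A + B * (\<Sum>k\<in>I. s k))"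
proof (cases "inj_on s I")
  case True
  have "weyl_down q I k s * (A + B * s k) =
     weyl q I s * (A * (1 / (\<Prod>j\<in>I-{k}. 1 - s j / s k)) + B * (s k / (\<Prod>j\<in>I-{k}. 1 - s j / s k)))"
    if k: "k \<in> I" for k
  proof -
    have "s i / s k \<noteq> 1" if "i \<in> I - {k}" for i
      using that True k nz[of k] by (auto simp: inj_on_def)
    hence "(\<Prod>i\<in>I-{k}. 1 - s i / s k) \<noteq> 0"
      using I by auto
    thus ?thesis
      using weyl_conv_down[OF q I(1) k, of s] by (simp add: field_simps)
  qed
  hence "(\<Sum>k\<in>I. weyl_down q I k s * (A + B * s k)) =
     (\<Sum>k\<in>I. weyl q I s * (A * (1 / (\<Prod>j\<in>I-{k}. 1 - s j / s k)) + B * (s k / (\<Prod>j\<in>I-{k}. 1 - s j / s k))))"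
    by (intro sum.cong) auto
  also have "\<dots> = weyl q I s * (A * (\<Sum>k\<in>I. 1 / (\<Prod>j\<in>I-{k}. 1 - s j / s k)) +
                    B * (\<Sum>k\<in>I. s k / (\<Prod>j\<in>I-{k}. 1 - s j / s k)))"
    by (simp only: sum_distrib_left[symmetric] sum.distrib)
  also have "\<dots> = weyl q I s * (A + B * (\<Sum>k\<in>I. s k))"
    by (simp only: lagrange_sum_inverse[OF I True nz] mult_1_right)
  finally show ?thesis .
next
  case False
  then obtain a b where "a \<in> I" "b \<in> I" "a \<noteq> b" "s a = s b"
    by (auto simp: inj_on_def)
  thus ?thesis
    using weyl_coincident[OF q I(1), of a b s] nz by simp
qed

text \<open>Replacing \<open>s k\<close> by \<open>q * s k\<close> divides each
  \<open>s i / s k\<close> by \<open>q\<close>, which the \<open>q\<close> in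
  \<open>weyl_down\<close> absorbs, and multiplies each \<open>s k / s j\<close> by
  \<open>q\<close>, which is the \<open>q\<close> in \<open>weyl_up\<close>.\<close>

lemma weyl_down_shift:
  assumes "q \<noteq> 0"
  shows "weyl_down q I k (\<lambda>i. if i = k then q * s i else s i) = weyl_up q I k s"
  unfolding weyl_down_def weyl_up_def using assms by (intro prod.cong refl) auto

lemma torusfn_weyl:
  assumes "norm q < 1"
  shows "torusfn I (weyl q I)" "torusfn I (weyl_up q I k)" "torusfn I (weyl_down q I k)"
  unfolding weyl_def weyl_up_def weyl_down_def
  by (intro torusfn_intros torusfn_qpinf assms; simp)+

lemma avg_tendsto:
  assumes I: "finite I" and F: "\<And>n. bfun I (F n)" and G: "bfun I G"
    and lim: "\<And>s. (\<And>i. norm (s i) = 1) \<Longrightarrow> (\<lambda>n. F n s) \<longlonglongrightarrow> G s"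
    and bound: "\<And>n s. (\<And>i. norm (s i) = 1) \<Longrightarrow> norm (F n s) \<le> B"
  shows "(\<lambda>n. avg I (F n)) \<longlonglongrightarrow> avg I G"
  unfolding avg_def
proof (intro tendsto_divide tendsto_const)
  interpret finite_measure "PiM I (\<lambda>_. angle)"
    by (rule finite_measure_angles[OF I])
  show "(\<lambda>n. LINT \<theta>|PiM I (\<lambda>_. angle). F n (\<lambda>i. cis (\<theta> i))) \<longlonglongrightarrow>
        (LINT \<theta>|PiM I (\<lambda>_. angle). G (\<lambda>i. cis (\<theta> i)))"
    by (rule integral_dominated_convergence[where w = "\<lambda>_. B"])
       (auto intro!: bfun_measurable_angles F G lim bound)
qed auto

lemma avg_scale_const:
  assumes F: "torusfn I F" and I: "finite I" "J \<subseteq> I" and c: "c \<noteq> 0"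
  shows "avg I (\<lambda>s. F (\<lambda>i. if i \<in> J then c * s i else s i)) = avg I F"
proof (rule avg_scale[OF F I])
  \<comment> \<open>At least 1, and at least both \<open>norm c\<close> and its reciprocal, so the
    annulus contains the unit circle and \<open>c\<close>.\<close>
  let ?R = "1 + norm c + 1 / norm c"
  show "1 \<le> ?R"
    by simp
  have "1 / ?R \<le> 1 / (1 / norm c)"
    using c by (intro divide_left_mono mult_pos_pos add_pos_pos) auto
  thus "1 / ?R \<le> norm c \<and> norm c \<le> ?R"
    by simp
qed (auto intro: bfun_const)

section \<open>Moments\<close>

definition matter :: "complex \<Rightarrow> 'i set \<Rightarrow> complex \<Rightarrow> ('i \<Rightarrow> complex) \<Rightarrow> complex" where
  "matter q I z s = (\<Prod>i\<in>I. qpinf (z * s i) q)"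

definition moment :: "complex \<Rightarrow> 'i set \<Rightarrow> complex \<Rightarrow> int \<Rightarrow> complex" where
  "moment q I z n = avg I (\<lambda>s. weyl q I s * (matter q I z s * (\<Prod>i\<in>I. s i) powi (-n)))"

definition moment1 :: "complex \<Rightarrow> 'i set \<Rightarrow> complex \<Rightarrow> int \<Rightarrow> complex" where
  "moment1 q I z n =
     avg I (\<lambda>s. weyl q I s * (\<Sum>i\<in>I. s i) * (matter q I z s * (\<Prod>i\<in>I. s i) powi (-n)))"

lemma torusfn_matter: "norm q < 1 \<Longrightarrow> torusfn I (matter q I z)"
  unfolding matter_def by (intro torusfn_intros torusfn_qpinf) auto

lemma matter_rec:
  "norm q < 1 \<Longrightarrow> matter q I z s = (\<Prod>i\<in>I. 1 - z * s i) * matter q I (q * z) s"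
  unfolding matter_def prod.distrib[symmetric] mult.assoc[of q] by (intro prod.cong refl qpinf_rec)

text \<open>The factor of \<open>s k\<close> reaches parameter \<open>q * z\<close> by the shift
  itself; the others reach it by releasing \<open>1 - z * s i\<close>. The released factors form the
  Lagrange numerator in \<open>weyl_up_sum\<close>.\<close>

lemma matter_shift:
  assumes q: "norm q < 1" and I: "finite I" "k \<in> I"
  shows "matter q I z (\<lambda>i. if i = k then q * s i else s i) =
         (\<Prod>i\<in>I-{k}. 1 - z * s i) * matter q I (q * z) s"
proof -
  have "matter q I z (\<lambda>i. if i = k then q * s i else s i) =
        qpinf (q * z * s k) q * matter q (I - {k}) z s"
    unfolding matter_def using I by (subst prod.remove[of _ k]) (auto simp: mult_ac intro!: prod.cong)
  also have "matter q (I - {k}) z s = (\<Prod>i\<in>I-{k}. 1 - z * s i) * matter q (I - {k}) (q * z) s"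
    by (rule matter_rec[OF q])
  also have "qpinf (q * z * s k) q * ((\<Prod>i\<in>I-{k}. 1 - z * s i) * matter q (I - {k}) (q * z) s) =
             (\<Prod>i\<in>I-{k}. 1 - z * s i) * matter q I (q * z) s"
    unfolding matter_def using prod.remove[OF I, of "\<lambda>i. qpinf (q * z * s i) q"] by simp
  finally show ?thesis .
qed

lemma prod_shift:
  fixes s :: "'i \<Rightarrow> complex"
  assumes I: "finite I" "k \<in> I"
  shows "(\<Prod>i\<in>I. if i = k then q * s i else s i) = q * (\<Prod>i\<in>I. s i)"
proof -
  have "(\<Prod>i\<in>I. if i = k then q * s i else s i) = (\<Prod>i\<in>I. (if i = k then q else 1) * s i)"
    by (rule prod.cong) auto
  thus ?thesis
    using I by (simp add: prod.distrib)
qed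

text \<open>This is the self-adjointness of the t = 0 Macdonald operator.\<close>

lemma avg_weyl_shift:
  assumes q: "norm q < 1" "q \<noteq> 0" and I: "finite I" "I \<noteq> {}"
    and H: "\<And>k. k \<in> I \<Longrightarrow> torusfn I (H k)"
  shows "avg I (\<lambda>s. \<Sum>k\<in>I. weyl_down q I k s * H k s) =
         avg I (\<lambda>s. \<Sum>k\<in>I. weyl_up q I k s * H k (\<lambda>i. if i = k then q * s i else s i))"
proof -
  have tor: "torusfn I (\<lambda>s. weyl_down q I k s * H k s)" if "k \<in> I" for k
    using that by (intro torusfn_mult torusfn_weyl q H)
  have shift: "avg I (\<lambda>s. weyl_up q I k s * H k (\<lambda>i. if i = k then q * s i else s i)) =
        avg I (\<lambda>s. weyl_down q I k s * H k s)" if k: "k \<in> I" for k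
    using avg_scale_const[OF tor[OF k] I(1), of "{k}" q] k q by (simp add: weyl_down_shift)
  have bf: "bfun I (\<lambda>s. weyl_up q I k s * H k (\<lambda>i. if i = k then q * s i else s i))" if k: "k \<in> I" for k
  proof (intro bfun_mult torusfn_imp_bfun[OF torusfn_weyl(2)] q)
    let ?R = "1 + norm q + 1 / norm q"
    have R: "1 / ?R \<le> norm q \<and> norm q \<le> ?R" "1 / ?R \<le> 1"
    proof -
      have "1 / ?R \<le> 1 / (1 / norm q)"
        using q by (intro divide_left_mono mult_pos_pos add_pos_pos) auto
      thus "1 / ?R \<le> norm q \<and> norm q \<le> ?R"
        by simp
      show "1 / ?R \<le> 1"
        by (simp add: divide_le_eq_1 add_pos_nonneg)
    qed
    show "bfun I (\<lambda>s. H k (\<lambda>i. if i = k then q * s i else s i))"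
    proof (rule torusfn_compose_bfun[OF H[OF k], of ?R])
      show "bfun I (\<lambda>s. if i = k then q * s i else s i)" if "i \<in> I" for i
        using that by (cases "i = k") (auto intro!: torusfn_imp_bfun torusfn_intros)
      show "1 / ?R \<le> norm (if i = k then q * s i else s i) \<and> norm (if i = k then q * s i else s i) \<le> ?R"
        if "\<And>j. norm (s j) = 1" for i s
        using that R by (simp add: norm_mult)
    qed auto
  qed
  show ?thesis
    using I by (subst (1 2) avg_sum) (auto intro!: sum.cong torusfn_imp_bfun[OF tor] bf simp: shift)
qed

lemma torusfn_matter_prod:
  "norm q < 1 \<Longrightarrow> torusfn I (\<lambda>s. matter q I z s * (\<Prod>i\<in>I. s i) powi m)"
  by (intro torusfn_mult torusfn_matter torusfn_power_int_prod) auto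

lemma torusfn_moment: "norm q < 1 \<Longrightarrow> torusfn I (\<lambda>s. weyl q I s * (matter q I z s * (\<Prod>i\<in>I. s i) powi m))"
  by (intro torusfn_mult[OF torusfn_weyl(1)] torusfn_matter_prod)

lemma torusfn_moment1:
  "norm q < 1 \<Longrightarrow>
     torusfn I (\<lambda>s. weyl q I s * (\<Sum>i\<in>I. s i) * (matter q I z s * (\<Prod>i\<in>I. s i) powi m))"
  by (intro torusfn_mult[OF _ torusfn_matter_prod] torusfn_mult[OF torusfn_weyl(1)] torusfn_intros) auto

text \<open>The product of the variables picks up one \<open>q\<close> under the shift, whence
  \<open>q powi (-n)\<close>. The leading term of Lagrange interpolation contributes one more such
  product, which lowers \<open>n\<close> by 1, and keeps the parameter \<open>q * z\<close>; the
  other term recombines to \<open>z\<close> by \<open>matter_rec\<close>.\<close>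

lemma moment_rec:
  assumes q: "norm q < 1" "q \<noteq> 0" and I: "finite I" "I \<noteq> {}"
  shows "moment q I z n =
           q powi (-n) * (moment q I z n - (-z) ^ card I * moment q I (q * z) (n - 1))"
proof -
  let ?e = "\<lambda>s. (\<Prod>i\<in>I. s i :: complex)"
  have "moment q I z n =
        avg I (\<lambda>s. \<Sum>k\<in>I. weyl_down q I k s * (matter q I z s * ?e s powi (-n)))"
    unfolding moment_def
  proof (rule avg_cong)
    fix s :: "'a \<Rightarrow> complex"
    assume s: "\<And>i. norm (s i) = 1"
    show "weyl q I s * (matter q I z s * ?e s powi (-n)) =
          (\<Sum>k\<in>I. weyl_down q I k s * (matter q I z s * ?e s powi (-n)))"
      using weyl_down_sum[OF q(1) I, of s 1 0] torus_nonzero[of s] s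
      by (simp flip: sum_distrib_right)
  qed
  also have "\<dots> = avg I (\<lambda>s. \<Sum>k\<in>I. weyl_up q I k s *
      (matter q I z (\<lambda>i. if i = k then q * s i else s i) * (\<Prod>i\<in>I. if i = k then q * s i else s i) powi (-n)))"
    by (intro avg_weyl_shift q I torusfn_matter_prod)
  also have "\<dots> = avg I (\<lambda>s. q powi (-n) * (weyl q I s * (matter q I z s * ?e s powi (-n)) -
                 (-z) ^ card I * (weyl q I s * (matter q I (q * z) s * ?e s powi (-(n-1))))))"
  proof (rule avg_cong)
    fix s :: "'a \<Rightarrow> complex"
    assume s: "\<And>i. norm (s i) = 1"
    have "?e s \<noteq> 0"
      using torus_nonzero[of s] s I by simp
    hence e: "?e s powi (-(n-1)) = ?e s powi (-n) * ?e s"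
      using power_int_add_1[of "?e s" "-n"] by simp
    have "(\<Sum>k\<in>I. weyl_up q I k s * (matter q I z (\<lambda>i. if i = k then q * s i else s i) *
            (\<Prod>i\<in>I. if i = k then q * s i else s i) powi (-n))) =
          (\<Sum>k\<in>I. weyl_up q I k s * (\<Prod>i\<in>I-{k}. 1 - z * s i)) *
            (matter q I (q * z) s * (q powi (-n) * ?e s powi (-n)))"
      unfolding sum_distrib_right
      by (intro sum.cong refl) (simp add: matter_shift q I prod_shift power_int_mult_distrib mult_ac)
    also have "\<dots> = weyl q I s * ((\<Prod>i\<in>I. 1 - z * s i) - (- z) ^ card I * ?e s) *
            (matter q I (q * z) s * (q powi (-n) * ?e s powi (-n)))"
      by (subst weyl_up_sum[OF q(1) I torus_nonzero[OF s]]) auto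
    also have "\<dots> = q powi (-n) * (weyl q I s * ((\<Prod>i\<in>I. 1 - z * s i) * matter q I (q * z) s * ?e s powi (-n)) -
                 (-z) ^ card I * (weyl q I s * (matter q I (q * z) s * ?e s powi (-(n-1)))))"
      unfolding e by (simp only: algebra_simps)
    finally show "(\<Sum>k\<in>I. weyl_up q I k s * (matter q I z (\<lambda>i. if i = k then q * s i else s i) *
            (\<Prod>i\<in>I. if i = k then q * s i else s i) powi (-n))) =
          q powi (-n) * (weyl q I s * (matter q I z s * ?e s powi (-n)) -
                 (-z) ^ card I * (weyl q I s * (matter q I (q * z) s * ?e s powi (-(n-1)))))"
      using matter_rec[OF q(1), of I z s] by simp
  qed
  also have "\<dots> = q powi (-n) * (moment q I z n - (-z) ^ card I * moment q I (q * z) (n - 1))"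
    unfolding avg_cmult moment_def
    by (subst avg_diff, (intro I torusfn_imp_bfun torusfn_cmult torusfn_moment q)+)
       (simp only: avg_cmult)
  finally show ?thesis .
qed

text \<open>Under the shift the insertion \<open>1 - z * s k / q\<close> becomes
  \<open>1 - z * s k\<close>, the one factor missing from the numerator in
  \<open>matter_shift\<close>. The matter factor is thereby restored at the unchanged parameter
  \<open>z\<close>.\<close>

lemma moment1_rec:
  assumes q: "norm q < 1" "q \<noteq> 0" and I: "finite I" "I \<noteq> {}"
  shows "moment q I z n - z / q * moment1 q I z n = q powi (-n) * moment q I z n"
proof -
  let ?e = "\<lambda>s. (\<Prod>i\<in>I. s i :: complex)"
  have "moment q I z n - z / q * moment1 q I z n =
        avg I (\<lambda>s. weyl q I s * (matter q I z s * ?e s powi (-n)) -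
                z / q * (weyl q I s * (\<Sum>i\<in>I. s i) * (matter q I z s * ?e s powi (-n))))"
    unfolding moment_def moment1_def
    by (subst avg_diff, (intro I torusfn_imp_bfun torusfn_cmult torusfn_moment torusfn_moment1 q)+)
       (simp only: avg_cmult)
  also have "\<dots> =
        avg I (\<lambda>s. \<Sum>k\<in>I. weyl_down q I k s * ((1 + (- z / q) * s k) * (matter q I z s * ?e s powi (-n))))"
  proof (rule avg_cong)
    fix s :: "'a \<Rightarrow> complex"
    assume s: "\<And>i. norm (s i) = 1"
    have "(\<Sum>k\<in>I. weyl_down q I k s * ((1 + (- z / q) * s k) * (matter q I z s * ?e s powi (-n)))) =
          weyl q I s * (1 + (- z / q) * (\<Sum>k\<in>I. s k)) * (matter q I z s * ?e s powi (-n))"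
      unfolding mult.assoc[symmetric, of "weyl_down q I _ s"] sum_distrib_right[symmetric]
      by (subst weyl_down_sum[OF q(1) I torus_nonzero[OF s]]) auto
    thus "weyl q I s * (matter q I z s * ?e s powi (-n)) -
             z / q * (weyl q I s * (\<Sum>i\<in>I. s i) * (matter q I z s * ?e s powi (-n))) =
          (\<Sum>k\<in>I. weyl_down q I k s * ((1 + (- z / q) * s k) * (matter q I z s * ?e s powi (-n))))"
      by (simp add: algebra_simps)
  qed
  also have "\<dots> = avg I (\<lambda>s. \<Sum>k\<in>I. weyl_up q I k s *
      ((1 + (- z / q) * (if k = k then q * s k else s k)) *
       (matter q I z (\<lambda>i. if i = k then q * s i else s i) * (\<Prod>i\<in>I. if i = k then q * s i else s i) powi (-n))))"
    by (intro avg_weyl_shift q I torusfn_mult[OF _ torusfn_matter_prod] torusfn_intros) auto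
  also have "\<dots> = avg I (\<lambda>s. q powi (-n) * (weyl q I s * (matter q I z s * ?e s powi (-n))))"
  proof (rule avg_cong)
    fix s :: "'a \<Rightarrow> complex"
    assume s: "\<And>i. norm (s i) = 1"
    \<comment> \<open>No numerator is left in the summands; the trivial factors
      \<open>1 - 0 * s i\<close> bring the sum into the form of \<open>weyl_up_sum\<close> at
      parameter 0.\<close>
    have "(\<Sum>k\<in>I. weyl_up q I k s * ((1 + (- z / q) * (if k = k then q * s k else s k)) *
       (matter q I z (\<lambda>i. if i = k then q * s i else s i) * (\<Prod>i\<in>I. if i = k then q * s i else s i) powi (-n)))) =
       (\<Sum>k\<in>I. weyl_up q I k s * (\<Prod>i\<in>I-{k}. 1 - 0 * s i)) * (q powi (-n) * (matter q I z s * ?e s powi (-n)))"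
      unfolding sum_distrib_right
    proof (intro sum.cong refl)
      fix k assume k: "k \<in> I"
      have "(1 - z * s k) * matter q I z (\<lambda>i. if i = k then q * s i else s i) = matter q I z s"
        unfolding matter_shift[OF q(1) I(1) k] using matter_rec[OF q(1), of I z s] prod.remove[OF I(1) k, of "\<lambda>i. 1 - z * s i"]
        by simp
      thus "weyl_up q I k s * ((1 + (- z / q) * (if k = k then q * s k else s k)) *
         (matter q I z (\<lambda>i. if i = k then q * s i else s i) * (\<Prod>i\<in>I. if i = k then q * s i else s i) powi (-n))) =
         weyl_up q I k s * (\<Prod>i\<in>I-{k}. 1 - 0 * s i) * (q powi (-n) * (matter q I z s * ?e s powi (-n)))"
        using q by (simp add: prod_shift I k power_int_mult_distrib mult.assoc[symmetric])
    qed
    also have "\<dots> = weyl q I s * ((\<Prod>i\<in>I. 1 - 0 * s i) - (- 0) ^ card I * ?e s) * (q powi (-n) * (matter q I z s * ?e s powi (-n)))"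
      by (subst weyl_up_sum[OF q(1) I torus_nonzero[OF s]]) auto
    also have "\<dots> = q powi (-n) * (weyl q I s * (matter q I z s * ?e s powi (-n)))"
      using I by (simp add: power_0_left mult_ac)
    finally show "(\<Sum>k\<in>I. weyl_up q I k s * ((1 + (- z / q) * (if k = k then q * s k else s k)) *
       (matter q I z (\<lambda>i. if i = k then q * s i else s i) * (\<Prod>i\<in>I. if i = k then q * s i else s i) powi (-n)))) =
       q powi (-n) * (weyl q I s * (matter q I z s * ?e s powi (-n)))" .
  qed
  also have "\<dots> = q powi (-n) * moment q I z n"
    unfolding avg_cmult moment_def ..
  finally show ?thesis .
qed

lemma matter_bounded:
  assumes q: "norm q < 1"
  obtains C where "\<And>y s. norm y \<le> norm z \<Longrightarrow> (\<And>i. norm (s i) = 1) \<Longrightarrow> norm (matter q I y s) \<le> C"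
proof -
  obtain C where C: "\<And>a. norm a \<le> norm z \<Longrightarrow> norm (qpinf a q) \<le> C"
    using qpinf_bounded[OF q] by blast
  have "norm (matter q I y s) \<le> C ^ card I" if "norm y \<le> norm z" "\<And>i. norm (s i) = 1" for y and s :: "'a \<Rightarrow> complex"
  proof -
    have "norm (matter q I y s) \<le> (\<Prod>i\<in>I. C)"
      unfolding matter_def prod_norm[symmetric]
      using that by (intro prod_mono conjI norm_ge_zero C) (auto simp: norm_mult)
    thus ?thesis by simp
  qed
  thus ?thesis using that by blast
qed

text \<open>For \<open>n = 0\<close> a common scaling of the variables by \<open>c\<close> only
  replaces \<open>z\<close> by \<open>c * z\<close>, since the weight depends on ratios. The moment
  is thus constant along this ray, and as \<open>c\<close> tends to 0 the matter factor tends to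
  1.\<close>

lemma moment_0:
  assumes q: "norm q < 1" and I: "finite I"
  shows "moment q I z 0 = avg I (weyl q I)"
proof -
  let ?F = "\<lambda>z s. weyl q I s * matter q I z s"
  have tor: "torusfn I (?F z)" for z
    by (intro torusfn_mult torusfn_weyl torusfn_matter q)
  have scale: "avg I (?F (c * z)) = avg I (?F z)" if c: "c \<noteq> 0" for c
  proof -
    have "avg I (\<lambda>s. ?F z (\<lambda>i. if i \<in> I then c * s i else s i)) = avg I (?F z)"
      by (intro avg_scale_const tor I c) auto
    moreover have "?F z (\<lambda>i. if i \<in> I then c * s i else s i) = ?F (c * z) s" for s
    proof -
      have "weyl q I (\<lambda>i. if i \<in> I then c * s i else s i) = weyl q I s"
        unfolding weyl_def using c by (intro prod.cong) auto
      moreover have "matter q I z (\<lambda>i. if i \<in> I then c * s i else s i) = matter q I (c * z) s"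
        unfolding matter_def by (intro prod.cong) (auto simp: mult_ac)
      ultimately show ?thesis by simp
    qed
    ultimately show ?thesis by simp
  qed
  obtain A where A: "A \<ge> 0" "\<And>s. (\<And>i. norm (s i) = 1) \<Longrightarrow> norm (weyl q I s) \<le> A"
    using bfun_bounded[OF torusfn_imp_bfun[OF torusfn_weyl(1)[OF q]]] by blast
  obtain C where C: "\<And>y s. norm y \<le> norm z \<Longrightarrow> (\<And>i. norm (s i) = 1) \<Longrightarrow> norm (matter q I y s) \<le> C"
    using matter_bounded[OF q] by blast
  define c where "c = (\<lambda>n. of_real (1 / real (Suc n)) :: complex)"
  have c0: "c \<longlonglongrightarrow> of_real 0"
    unfolding c_def using LIMSEQ_inverse_real_of_nat by (intro tendsto_of_real) (simp add: inverse_eq_divide)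
  have "norm (c n) \<le> 1" for n
    unfolding c_def norm_of_real by simp
  hence cz: "norm (c n * z) \<le> norm z" for n
    by (simp add: norm_mult mult_left_le_one_le)
  have "(\<lambda>n. avg I (?F (c n * z))) \<longlonglongrightarrow> avg I (weyl q I)"
  proof (rule avg_tendsto[OF I])
    fix n and s :: "'a \<Rightarrow> complex"
    assume s: "\<And>i. norm (s i) = 1"
    show "norm (?F (c n * z) s) \<le> A * C"
      unfolding norm_mult using A s cz by (intro mult_mono C) auto
    have "isCont (\<lambda>a. qpinf a q) 0"
      using qpinf_continuous[OF q, of UNIV] by (simp add: continuous_on_eq_continuous_at)
    moreover have "(\<lambda>n. c n * z * s i) \<longlonglongrightarrow> 0" for i
      using c0 by (intro tendsto_mult_left_zero) auto
    ultimately have "(\<lambda>n. qpinf (c n * z * s i) q) \<longlonglongrightarrow> qpinf 0 q" for i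
      using isCont_tendsto_compose by blast
    hence "(\<lambda>n. ?F (c n * z) s) \<longlonglongrightarrow> weyl q I s * (\<Prod>i\<in>I. 1)"
      unfolding matter_def by (intro tendsto_mult tendsto_const tendsto_prod) simp
    thus "(\<lambda>n. ?F (c n * z) s) \<longlonglongrightarrow> weyl q I s"
      by simp
  qed (intro torusfn_imp_bfun tor torusfn_weyl q)+
  moreover have "avg I (?F (c n * z)) = avg I (?F z)" for n
    by (rule scale) (simp add: c_def del: of_real_divide of_nat_Suc)
  ultimately have "avg I (?F z) = avg I (weyl q I)"
    by (simp add: LIMSEQ_const_iff)
  thus ?thesis
    by (simp add: moment_def)
qed

text \<open>The induction keeps \<open>z\<close> arbitrary because the recurrence moves to
  \<open>q * z\<close>. Each such move contributes \<open>q ^ (card I * n)\<close>, and these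
  exponents add up to the triangular sum.\<close>

lemma moment_nat:
  assumes q: "norm q < 1" "q \<noteq> 0" and I: "finite I" "I \<noteq> {}"
  shows "moment q I z (int n) =
    (-1) ^ (card I * n) * q ^ (card I * (\<Sum>k<n. k)) * z ^ (card I * n) / qpoch q q n * avg I (weyl q I)"
proof (induction n arbitrary: z)
  case 0
  show ?case
    using moment_0[OF q(1) I(1)] by (simp add: qpoch_def)
next
  case (Suc n)
  let ?N = "card I"
  define M where "M = moment q I z (int (Suc n))"
  have "M = q powi (- int (Suc n)) * (M - (-z) ^ ?N * moment q I (q * z) (int n))"
    using moment_rec[OF q I, of z "int (Suc n)"] by (simp add: M_def)
  hence "q powi (int (Suc n)) * M = M - (-z) ^ ?N * moment q I (q * z) (int n)"
    using q by (metis (no_types, lifting) mult.left_commute mult_1_right power_int_minus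
      power_int_not_zero right_inverse)
  hence "M * (1 - q * q ^ n) = (-z) ^ ?N * moment q I (q * z) (int n)"
    unfolding power_int_of_nat by (simp add: algebra_simps)
  hence "M = (-z) ^ ?N * moment q I (q * z) (int n) / (1 - q * q ^ n)"
    using one_minus_qpower_nz[OF q(1), of n] by (simp add: eq_divide_eq)
  also have "\<dots> = (-1) ^ (?N * Suc n) * q ^ (?N * (\<Sum>k<Suc n. k)) * z ^ (?N * Suc n) / qpoch q q (Suc n) * avg I (weyl q I)"
    unfolding Suc.IH qpoch_Suc
    by (simp add: power_add power_mult_distrib power_mult power_minus[of z] distrib_left mult_ac)
  finally show ?case
    by (simp only: M_def)
qed

text \<open>At \<open>n = 0\<close> the two equal moments in the recurrence cancel and leave a
  nonzero multiple of the one at -1; the vanishing then propagates downwards. The recurrence is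
  taken at \<open>z / q\<close> so that its last moment has parameter \<open>z\<close>.\<close>

lemma moment_neg:
  assumes q: "norm q < 1" "q \<noteq> 0" and I: "finite I" "I \<noteq> {}" and z: "z \<noteq> 0"
  shows "moment q I z (- int (Suc n)) = 0"
  using z
proof (induction n arbitrary: z)
  case 0
  have "(-(z/q)) ^ card I * moment q I z (-1) = 0"
    using moment_rec[OF q I, of "z/q" 0] q by simp
  thus ?case
    using 0 q by simp
next
  case (Suc n)
  have "moment q I (z/q) (- int (Suc n)) = 0"
    using Suc q by auto
  hence "(-(z/q)) ^ card I * moment q I z (- int (Suc n) - 1) = 0"
    using moment_rec[OF q I, of "z/q" "- int (Suc n)"] q by simp
  thus ?case
    using Suc.prems q by (simp add: algebra_simps)
qed

lemma moment1_eq: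
  assumes q: "norm q < 1" "q \<noteq> 0" and I: "finite I" "I \<noteq> {}" and z: "z \<noteq> 0"
  shows "moment1 q I z n = q / z * (1 - q powi (-n)) * moment q I z n"
  using moment1_rec[OF q I, of z n] q z by (simp add: field_simps)

text \<open>By the recurrence, \<open>1 - q powi (-n)\<close> times a moment is a multiple of the
  preceding moment. The newest factor of the denominator is thus cancelled, leaving
  \<open>qpoch q q n\<close> at index \<open>Suc n\<close>.\<close>

lemma moment1_nat:
  assumes q: "norm q < 1" "q \<noteq> 0" and I: "finite I" "I \<noteq> {}" and z: "z \<noteq> 0"
  shows "moment1 q I z (int (Suc n)) = (-1) ^ (card I * n + (card I - 1)) *
    q ^ (card I * (\<Sum>k<n. k) + (card I - 1) * n) * z ^ (card I * n + (card I - 1)) / qpoch q q n * avg I (weyl q I)"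
proof -
  obtain N where N: "card I = Suc N"
    using I by (metis card_gt_0_iff gr0_implies_Suc)
  have "moment1 q I z (int (Suc n)) = q / z * ((1 - q powi (- int (Suc n))) * moment q I z (int (Suc n)))"
    using moment1_eq[OF q I z] by simp
  also have "(1 - q powi (- int (Suc n))) * moment q I z (int (Suc n)) =
      - (q powi (- int (Suc n))) * (-z) ^ card I * moment q I (q * z) (int n)"
    using moment_rec[OF q I, of z "int (Suc n)"] by (simp add: algebra_simps)
  also have "q / z * \<dots> = - (inverse (q ^ n)) * (- 1) ^ card I * z ^ N * moment q I (q * z) (int n)"
    unfolding power_int_minus power_int_of_nat
    using q z by (simp add: N power_minus[of z] field_simps)
  also have "\<dots> = (-1) ^ (card I * n + (card I - 1)) *
    q ^ (card I * (\<Sum>k<n. k) + (card I - 1) * n) * z ^ (card I * n + (card I - 1)) / qpoch q q n * avg I (weyl q I)"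
    unfolding moment_nat[OF q I] using q
    by (simp add: N power_add power_mult_distrib power_mult field_simps)
  finally show ?thesis .
qed

lemma moment1_neg:
  assumes q: "norm q < 1" "q \<noteq> 0" and I: "finite I" "I \<noteq> {}" and z: "z \<noteq> 0"
  shows "moment1 q I z 0 = 0" "moment1 q I z (- int (Suc n)) = 0"
  unfolding moment1_eq[OF assms] moment_neg[OF assms] by simp_all

section \<open>Normalization\<close>

text \<open>Taking \<open>- s / q ^ (n - k)\<close> out of \<open>1 - s / q ^ n * q ^ k\<close>
  leaves \<open>1 - q ^ (n - k) / s\<close>; in reverse order these are the factors on the
  right.\<close>

lemma qpoch_reflect:
  assumes "q \<noteq> 0" "s \<noteq> 0"
  shows "qpoch (s / q ^ n) q n * s powi (- int n) * (-1) ^ n * q ^ (\<Sum>k<n. Suc k) = qpoch (q / s) q n"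
proof -
  have "qpoch (q / s) q n = (\<Prod>k<n. 1 - q / s * q ^ (n - Suc k))"
    unfolding qpoch_def by (rule prod.nat_diff_reindex[symmetric])
  also have "\<dots> = (\<Prod>k<n. (1 - s / q ^ n * q ^ k) * (inverse s * (-1) * q ^ (n - k)))"
  proof (rule prod.cong[OF refl])
    fix k assume "k \<in> {..<n}"
    then obtain m where m: "n = Suc (k + m)"
      using less_iff_Suc_add by auto
    show "1 - q / s * q ^ (n - Suc k) = (1 - s / q ^ n * q ^ k) * (inverse s * (-1) * q ^ (n - k))"
      using assms by (simp add: m power_add field_simps)
  qed
  also have "\<dots> = qpoch (s / q ^ n) q n * (inverse s ^ n * (-1) ^ n * (\<Prod>k<n. q ^ (n - k)))"
    by (simp only: prod.distrib prod_constant card_lessThan qpoch_def mult.assoc)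
  also have "(\<Prod>k<n. q ^ (n - k)) = (\<Prod>k<n. q ^ Suc (n - Suc k))"
    by (intro prod.cong refl) (auto simp: Suc_diff_Suc)
  also have "\<dots> = (\<Prod>k<n. q ^ Suc k)"
    by (rule prod.nat_diff_reindex)
  also have "\<dots> = q ^ (\<Sum>k<n. Suc k)"
    by (simp add: power_sum)
  finally show ?thesis
    by (simp add: power_int_minus power_inverse mult_ac)
qed

lemma avg_theta:
  assumes q: "norm q < 1" and I: "finite I" "I \<noteq> {}"
  shows "avg I (\<lambda>s. weyl q I s * (\<Prod>i\<in>I. qpinf (s i) q * qpinf (q / s i) q)) = avg I (weyl q I) / qpinf q q"
proof (cases "q = 0")
  case True
  have "avg I (\<lambda>s. weyl q I s * (\<Prod>i\<in>I. qpinf (s i) q * qpinf (q / s i) q)) = moment q I 1 0"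
    by (simp add: moment_def matter_def True)
  thus ?thesis
    using moment_0[OF q I(1)] True by simp
next
  case False
  let ?N = "card I"
  define F where "F = (\<lambda>n s. weyl q I s * (\<Prod>i\<in>I. qpinf (s i) q * qpoch (q / s i) q n))"
  have F: "torusfn I (F n)" for n
    unfolding F_def qpoch_def by (intro torusfn_intros torusfn_weyl torusfn_qpinf q) auto
  have "avg I (F n) = avg I (weyl q I) / qpoch q q n" for n
  proof -
    \<comment> \<open>The constant of \<open>qpoch_reflect\<close>, which turns the truncated theta
      function into matter at \<open>z = 1 / q ^ n\<close> times a power of the variable.\<close>
    define K where "K = (-1) ^ n * q ^ (\<Sum>k<n. Suc k)"
    have "avg I (F n) = avg I (\<lambda>s. K ^ ?N * (weyl q I s * (matter q I (1 / q ^ n) s * (\<Prod>i\<in>I. s i) powi (- int n))))"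
    proof (rule avg_cong)
      fix s :: "'a \<Rightarrow> complex"
      assume s: "\<And>i. norm (s i) = 1"
      have nz: "s i \<noteq> 0" for i
        using torus_nonzero[of s i] s by simp
      have "qpinf (s i) q * qpoch (q / s i) q n = K * (qpinf (1 / q ^ n * s i) q * s i powi (- int n))" for i
        unfolding qpoch_reflect[OF False nz, symmetric] K_def
        using qpinf_eq_qpoch[OF q, of "s i / q ^ n" n] False by (simp add: mult_ac)
      hence "(\<Prod>i\<in>I. qpinf (s i) q * qpoch (q / s i) q n) =
             K ^ ?N * (matter q I (1 / q ^ n) s * (\<Prod>i\<in>I. s i powi (- int n)))"
        by (simp add: prod.distrib matter_def)
      also have "(\<Prod>i\<in>I. s i powi (- int n)) = (\<Prod>i\<in>I. s i) powi (- int n)"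
        by (rule prod_power_int[symmetric])
      finally show "F n s = K ^ ?N * (weyl q I s * (matter q I (1 / q ^ n) s * (\<Prod>i\<in>I. s i) powi (- int n)))"
        by (simp add: F_def mult_ac)
    qed
    also have "\<dots> = K ^ ?N * moment q I (1 / q ^ n) (int n)"
      unfolding avg_cmult moment_def ..
    also have "\<dots> = (K * (-1) ^ n * q ^ (\<Sum>k<n. k) / q ^ (n * n)) ^ ?N / qpoch q q n * avg I (weyl q I)"
      unfolding moment_nat[OF q False I]
      by (simp add: power_mult_distrib power_divide power_mult[symmetric] mult_ac)
    \<comment> \<open>The triangular exponents n(n+1)/2 from \<open>K\<close> and n(n-1)/2 from
      \<open>moment_nat\<close> add up to the \<open>n * n\<close> coming from \<open>z\<close>, and
      the signs square to 1.\<close>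
    also have "K * (-1) ^ n * q ^ (\<Sum>k<n. k) / q ^ (n * n) = 1"
    proof -
      have "(\<Sum>k<n. Suc k) + (\<Sum>k<n. k) = n * n"
        by (induction n) auto
      hence "q ^ (\<Sum>k<n. Suc k) * q ^ (\<Sum>k<n. k) = q ^ (n * n)"
        by (simp only: power_add[symmetric])
      thus ?thesis
        using False by (simp add: K_def power_mult_distrib[symmetric] mult_ac)
    qed
    finally show ?thesis by simp
  qed
  moreover have "(\<lambda>n. avg I (weyl q I) / qpoch q q n) \<longlonglongrightarrow> avg I (weyl q I) / qpinf q q"
    by (intro tendsto_intros qpoch_LIMSEQ q qpinf_self_nz)
  ultimately have 1: "(\<lambda>n. avg I (F n)) \<longlonglongrightarrow> avg I (weyl q I) / qpinf q q"
    by simp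
  obtain A where A: "A \<ge> 0" "\<And>s. (\<And>i. norm (s i) = 1) \<Longrightarrow> norm (weyl q I s) \<le> A"
    using bfun_bounded[OF torusfn_imp_bfun[OF torusfn_weyl(1)[OF q]]] by blast
  obtain C where C: "\<And>a. norm a \<le> 1 \<Longrightarrow> norm (qpinf a q) \<le> C"
    using qpinf_bounded[OF q] by blast
  have "(\<lambda>n. avg I (F n)) \<longlonglongrightarrow> avg I (\<lambda>s. weyl q I s * (\<Prod>i\<in>I. qpinf (s i) q * qpinf (q / s i) q))"
  proof (rule avg_tendsto[OF I(1)])
    show "bfun I (F n)" for n
      by (rule torusfn_imp_bfun[OF F])
    show "bfun I (\<lambda>s. weyl q I s * (\<Prod>i\<in>I. qpinf (s i) q * qpinf (q / s i) q))"
      by (intro torusfn_imp_bfun torusfn_intros torusfn_weyl torusfn_qpinf q) auto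
    fix n and s :: "'a \<Rightarrow> complex"
    assume s: "\<And>i. norm (s i) = 1"
    show "(\<lambda>n. F n s) \<longlonglongrightarrow> weyl q I s * (\<Prod>i\<in>I. qpinf (s i) q * qpinf (q / s i) q)"
      unfolding F_def by (intro tendsto_intros qpoch_LIMSEQ q)
    have "norm (\<Prod>i\<in>I. qpinf (s i) q * qpoch (q / s i) q n) \<le> (\<Prod>i\<in>I. C * exp (norm q / (1 - norm q)))"
      unfolding prod_norm[symmetric]
    proof (intro prod_mono conjI norm_ge_zero)
      fix i assume "i \<in> I"
      have "norm (qpoch (q / s i) q n) \<le> exp (norm q / (1 - norm q))"
        using norm_qpoch_le[OF q, of "q / s i" n] s[of i] by (simp add: norm_divide)
      moreover have "norm (qpinf (s i) q) \<le> C"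
        using s[of i] by (intro C) auto
      ultimately show "norm (qpinf (s i) q * qpoch (q / s i) q n) \<le> C * exp (norm q / (1 - norm q))"
        unfolding norm_mult by (intro mult_mono) (auto intro: order.trans[OF norm_ge_zero])
    qed
    thus "norm (F n s) \<le> A * (\<Prod>i\<in>I. C * exp (norm q / (1 - norm q)))"
      unfolding F_def norm_mult using A(1) A(2)[OF s] by (intro mult_mono) auto
  qed
  thus ?thesis
    using LIMSEQ_unique[OF 1] by simp
qed

text \<open>Only ratios enter, so \<open>c\<close> cancels. Pairs without \<open>k\<close> give the
  weight of lower rank; pairs \<open>(i, k)\<close> and \<open>(k, j)\<close> give
  \<open>s i\<close> and, thanks to the \<open>q\<close> in \<open>weyl_up\<close>,
  \<open>q / s j\<close>.\<close>

lemma weyl_up_rescale: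
  assumes I: "finite J" "k \<notin> J" and c: "c \<noteq> 0"
  shows "weyl_up q (insert k J) k (\<lambda>i. if i \<in> J then c * s i else c) =
         weyl q J s * (\<Prod>i\<in>J. qpinf (s i) q * qpinf (q / s i) q)"
proof -
  let ?t = "\<lambda>i. if i \<in> J then c * s i else c"
  have split: "(\<Prod>i\<in>insert k J. \<Prod>j\<in>insert k J - {i}. f i j) =
      (\<Prod>j\<in>J. f k j) * (\<Prod>i\<in>J. \<Prod>j\<in>insert k (J - {i}). f i j)" for f :: "'a \<Rightarrow> 'a \<Rightarrow> complex"
  proof -
    have "insert k J - {i} = insert k (J - {i})" if "i \<in> J" for i
      using that I by auto
    moreover have "insert k J - {k} = J"
      using I by auto
    ultimately show ?thesis
      using I by simp
  qed
  have "weyl_up q (insert k J) k ?t =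
        (\<Prod>j\<in>J. qpinf ((if k = k then q else 1) * (?t k / ?t j)) q) *
        (\<Prod>i\<in>J. \<Prod>j\<in>insert k (J - {i}). qpinf ((if i = k then q else 1) * (?t i / ?t j)) q)"
    unfolding weyl_up_def by (rule split)
  also have "(\<Prod>j\<in>J. qpinf ((if k = k then q else 1) * (?t k / ?t j)) q) = (\<Prod>j\<in>J. qpinf (q / s j) q)"
    using I c by (intro prod.cong) auto
  also have "(\<Prod>i\<in>J. \<Prod>j\<in>insert k (J - {i}). qpinf ((if i = k then q else 1) * (?t i / ?t j)) q) =
             (\<Prod>i\<in>J. qpinf (s i) q * (\<Prod>j\<in>J - {i}. qpinf (s i / s j) q))"
  proof (rule prod.cong[OF refl])
    fix i assume i: "i \<in> J"
    have "(\<Prod>j\<in>J - {i}. qpinf ((if i = k then q else 1) * (?t i / ?t j)) q) =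
          (\<Prod>j\<in>J - {i}. qpinf (s i / s j) q)"
      using I c i by (intro prod.cong) auto
    thus "(\<Prod>j\<in>insert k (J - {i}). qpinf ((if i = k then q else 1) * (?t i / ?t j)) q) =
          qpinf (s i) q * (\<Prod>j\<in>J - {i}. qpinf (s i / s j) q)"
      using I c i by (subst prod.insert) auto
  qed
  finally show ?thesis
    by (simp add: weyl_def prod.distrib mult_ac)
qed

text \<open>Scaling the variables in \<open>J\<close> by \<open>s k\<close> makes the integrand
  independent of \<open>s k\<close>, so that one integration disappears. On the torus the scaling
  factor has modulus 1, which is why \<open>R = 1\<close> serves.\<close>

lemma avg_weyl_up:
  assumes q: "norm q < 1" and J: "finite J" "k \<notin> J" "J \<noteq> {}"
  shows "avg (insert k J) (weyl_up q (insert k J) k) = avg J (weyl q J) / qpinf q q"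
proof -
  let ?I = "insert k J"
  let ?G = "\<lambda>s. weyl q J s * (\<Prod>i\<in>J. qpinf (s i) q * qpinf (q / s i) q)"
  have "avg ?I (weyl_up q ?I k) = avg ?I (\<lambda>s. weyl_up q ?I k (\<lambda>i. if i \<in> J then s k * s i else s i))"
    by (rule avg_scale[symmetric, where R = 1])
       (use J in \<open>auto intro!: torusfn_weyl q torusfn_imp_bfun[OF torusfn_coord]\<close>)
  also have "\<dots> = avg ?I ?G"
  proof (rule avg_cong)
    fix s :: "'a \<Rightarrow> complex"
    assume s: "\<And>i. norm (s i) = 1"
    have "weyl_up q ?I k (\<lambda>i. if i \<in> J then s k * s i else s i) =
          weyl_up q ?I k (\<lambda>i. if i \<in> J then s k * s i else s k)"
      unfolding weyl_up_def by (intro prod.cong refl) auto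
    also have "\<dots> = ?G s"
      using torus_nonzero[of s k] s J by (intro weyl_up_rescale) auto
    finally show "weyl_up q ?I k (\<lambda>i. if i \<in> J then s k * s i else s i) = ?G s" .
  qed
  also have "\<dots> = avg J ?G"
    by (intro avg_unused J torusfn_imp_bfun torusfn_intros torusfn_weyl torusfn_qpinf q) auto
  also have "\<dots> = avg J (weyl q J) / qpinf q q"
    by (rule avg_theta[OF q J(1,3)])
  finally show ?thesis .
qed

text \<open>The constant term of the weight is determined by induction on the rank: setting one variable
  to 1 produces the theta factors of the previous lemma.\<close>

lemma avg_weyl:
  assumes q: "norm q < 1" and I: "card I = Suc n"
  shows "avg I (weyl q I) = fact (Suc n) / qpinf q q ^ n"
  using I
proof (induction n arbitrary: I)
  case 0
  then obtain a where "I = {a}"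
    by (auto simp: card_Suc_eq)
  hence "weyl q I = (\<lambda>_. 1)"
    by (auto simp: weyl_def fun_eq_iff)
  thus ?case
    using \<open>I = {a}\<close> by simp
next
  case (Suc n)
  have I: "finite I" "I \<noteq> {}"
    using Suc.prems card.infinite by fastforce+
  \<comment> \<open>This is \<open>weyl_up_sum\<close> at parameter 0. The
    \<open>Suc (Suc n)\<close> summands have equal averages, which supplies the new factor of the
    factorial.\<close>
  have "avg I (weyl q I) = avg I (\<lambda>s. \<Sum>k\<in>I. weyl_up q I k s)"
  proof (rule avg_cong)
    fix s :: "'a \<Rightarrow> complex"
    assume s: "\<And>i. norm (s i) = 1"
    show "weyl q I s = (\<Sum>k\<in>I. weyl_up q I k s)"
      using weyl_up_sum[OF q I, of s 0] torus_nonzero[of s] s Suc.prems by simp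
  qed
  also have "\<dots> = (\<Sum>k\<in>I. avg I (weyl_up q I k))"
    by (intro avg_sum I torusfn_imp_bfun torusfn_weyl q)
  also have "\<dots> = (\<Sum>k\<in>I. fact (Suc n) / qpinf q q ^ n / qpinf q q)"
  proof (rule sum.cong[OF refl])
    fix k assume k: "k \<in> I"
    have card: "card (I - {k}) = Suc n"
      using Suc.prems k I by simp
    hence "I - {k} \<noteq> {}"
      by force
    have "avg (insert k (I - {k})) (weyl_up q (insert k (I - {k})) k) =
          avg (I - {k}) (weyl q (I - {k})) / qpinf q q"
      using I \<open>I - {k} \<noteq> {}\<close> by (intro avg_weyl_up q) simp_all
    thus "avg I (weyl_up q I k) = fact (Suc n) / qpinf q q ^ n / qpinf q q"
      using Suc.IH[OF card] k by (simp add: insert_absorb)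
  qed
  also have "\<dots> = fact (Suc (Suc n)) / qpinf q q ^ Suc n"
    using Suc.prems by (simp add: divide_divide_eq_left mult_ac)
  finally show ?case .
qed

section \<open>Vanishing of moments at \<open>z = 0\<close>, for the degenerate case
  \<open>q = 0\<close>\<close>

lemma moment_at_0:
  assumes q: "norm q < 1" and I: "finite I" "I \<noteq> {}" and n: "n \<noteq> 0"
  shows "moment q I 0 n = 0"
proof -
  let ?F = "\<lambda>s. weyl q I s * (matter q I 0 s * (\<Prod>i\<in>I. s i) powi (-n))"
  have "avg I ?F = avg I (\<lambda>s. ?F (\<lambda>i. if i \<in> I then 2 * s i else s i))"
    by (rule avg_scale_const[symmetric]) (use I q in \<open>auto intro: torusfn_moment\<close>)
  also have "\<dots> = avg I (\<lambda>s. 2 powi (- int (card I) * n) * ?F s)"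
  proof (rule avg_cong)
    fix s :: "'a \<Rightarrow> complex"
    have "weyl q I (\<lambda>i. if i \<in> I then 2 * s i else s i) = weyl q I s"
      unfolding weyl_def by (intro prod.cong) auto
    moreover have "(\<Prod>i\<in>I. if i \<in> I then 2 * s i else s i) = 2 ^ card I * (\<Prod>i\<in>I. s i)"
      by (simp add: prod.distrib)
    moreover have "(2 ^ card I :: complex) powi (-n) = 2 powi (- int (card I) * n)"
      by (simp flip: power_int_of_nat power_int_mult)
    ultimately show "?F (\<lambda>i. if i \<in> I then 2 * s i else s i) = 2 powi (- int (card I) * n) * ?F s"
      by (simp add: matter_def power_int_mult_distrib)
  qed
  also have "\<dots> = 2 powi (- int (card I) * n) * avg I ?F"
    by (rule avg_cmult)
  finally have "avg I ?F * (1 - 2 powi (- int (card I) * n)) = 0"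
    by (simp add: algebra_simps)
  moreover have "(2::complex) powi (- int (card I) * n) \<noteq> 1"
    using n I by (intro two_powi_neq_1) auto
  ultimately show ?thesis
    by (simp add: moment_def)
qed

text \<open>At \<open>z = 0\<close> the matter factor is 1 and the integrand is homogeneous of
  degree \<open>1 - int (card I) * n\<close>. This degree is never 0, because a cardinality of at
  least 2 does not divide 1.\<close>

lemma moment1_at_0:
  assumes q: "norm q < 1" and I: "card I \<ge> 2"
  shows "moment1 q I 0 n = 0"
proof -
  have fin: "finite I" "I \<noteq> {}"
    using I card.infinite by fastforce+
  let ?F = "\<lambda>s. weyl q I s * (\<Sum>i\<in>I. s i) * (matter q I 0 s * (\<Prod>i\<in>I. s i) powi (-n))"
  have "avg I ?F = avg I (\<lambda>s. ?F (\<lambda>i. if i \<in> I then 2 * s i else s i))"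
    by (rule avg_scale_const[symmetric]) (use fin q in \<open>auto intro: torusfn_moment1\<close>)
  also have "\<dots> = avg I (\<lambda>s. 2 powi (1 - int (card I) * n) * ?F s)"
  proof (rule avg_cong)
    fix s :: "'a \<Rightarrow> complex"
    have "weyl q I (\<lambda>i. if i \<in> I then 2 * s i else s i) = weyl q I s"
      unfolding weyl_def by (intro prod.cong) auto
    moreover have "(\<Prod>i\<in>I. if i \<in> I then 2 * s i else s i) = 2 ^ card I * (\<Prod>i\<in>I. s i)"
      by (simp add: prod.distrib)
    moreover have "(\<Sum>i\<in>I. if i \<in> I then 2 * s i else s i) = 2 * (\<Sum>i\<in>I. s i)"
      by (simp add: sum_distrib_left)
    moreover have "2 * (2 ^ card I :: complex) powi (-n) = 2 powi (1 - int (card I) * n)"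
      by (simp add: power_int_diff power_int_minus divide_inverse flip: power_int_of_nat power_int_mult)
    ultimately show "?F (\<lambda>i. if i \<in> I then 2 * s i else s i) = 2 powi (1 - int (card I) * n) * ?F s"
      by (simp add: matter_def power_int_mult_distrib)
  qed
  also have "\<dots> = 2 powi (1 - int (card I) * n) * avg I ?F"
    by (rule avg_cmult)
  finally have "avg I ?F * (1 - 2 powi (1 - int (card I) * n)) = 0"
    by (simp add: algebra_simps)
  moreover have "1 - int (card I) * n \<noteq> 0"
  proof
    assume "1 - int (card I) * n = 0"
    hence "int (card I) dvd 1"
      by (metis dvd_triv_left eq_iff_diff_eq_0)
    thus False
      using I by auto
  qed
  hence "(2::complex) powi (1 - int (card I) * n) \<noteq> 1"
    by (rule two_powi_neq_1)
  ultimately show ?thesis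
    by (simp add: moment1_def)
qed

section \<open>From torus averages to the Wilson lines\<close>

lemma wilson_eq_avg:
  assumes q: "norm q < 1" and N: "N \<ge> 2"
  shows "wilson N m x q h = qpinf q q ^ (N - 1) / of_nat (fact N) *
    avg {..<N-1} (\<lambda>s. (\<lambda>s. weyl q {..<N} s * matter q {..<N} (h * x) s * (\<Sum>i<N. s i powi m))
                       (s(N - 1 := inverse (\<Prod>i<N-1. s i))))"
proof -
  have "weyl q {..<N} (su_s N \<theta>) * matter q {..<N} (h * x) (su_s N \<theta>) * (\<Sum>i<N. su_s N \<theta> i powi m) =
     (\<lambda>s. weyl q {..<N} s * matter q {..<N} (h * x) s * (\<Sum>i<N. s i powi m))
                       ((\<lambda>i. cis (\<theta> i))(N - 1 := inverse (\<Prod>i<N-1. cis (\<theta> i))))" for \<theta>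
  proof -
    \<comment> \<open>The two points may differ at indices from \<open>N\<close> on, which no
      product or sum in the integrand reaches.\<close>
    have "((\<lambda>i. cis (\<theta> i))(N - 1 := inverse (\<Prod>i<N-1. cis (\<theta> i)))) i = su_s N \<theta> i" if "i < N" for i
      using that by (auto simp: su_s_def)
    thus ?thesis
      unfolding weyl_def matter_def by (simp del: fun_upd_apply)
  qed
  moreover have "(\<Prod>i<N. qpinf (h * su_s N \<theta> i * x) q) = matter q {..<N} (h * x) (su_s N \<theta>)" for \<theta>
    by (simp add: matter_def mult_ac)
  ultimately show ?thesis
    unfolding wilson_def avg_def angle_def weyl_def[symmetric] by simp
qed

text \<open>Converts triangular powers of \<open>q = h ^ 2\<close>, together with the powers of
  \<open>h\<close> coming from \<open>z = h * x\<close>, into the square exponents of the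
  theorem.\<close>

lemma sum_lessThan_id: "2 * (\<Sum>k<n. k) + n = n ^ 2" for n :: nat
  by (induction n) (auto simp: power2_eq_square)

context
  fixes N :: nat and x q h :: complex
  assumes N: "N \<ge> 2" and q: "norm q < 1" and h: "h ^ 2 = q" and x: "x \<noteq> 0"
begin

lemma index_set: "finite {..<N}" "{..<N} \<noteq> {}" "card {..<N} = Suc (N - 1)" "insert (N - 1) {..<N-1} = {..<N}"
  using N by (auto simp: lessThan_empty_iff)

lemma moment_term:
  "qpinf q q ^ (N - 1) / fact N * moment q {..<N} (h * x) (int n) =
     (-1) ^ (N * n) * h ^ (N * n ^ 2) * x ^ (N * n) / qpoch q q n"
proof -
  \<comment> \<open>The prefactor in \<open>wilson\<close> is the reciprocal of the average of the
    weight, so the series has leading term 1.\<close>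
  have C: "qpinf q q ^ (N - 1) / fact N * avg {..<N} (weyl q {..<N}) = 1"
    using avg_weyl[OF q index_set(3)] qpinf_self_nz[OF q] N by simp
  show ?thesis
  proof (cases "q = 0")
    case True
    hence h0: "h = 0"
      using h by simp
    show ?thesis
    proof (cases "n = 0")
      case True
      thus ?thesis
        using C moment_0[OF q index_set(1)] by (simp add: qpoch_def)
    next
      case False
      thus ?thesis
        using N moment_at_0[OF q index_set(1,2), of "int n"] by (simp add: h0)
    qed
  next
    case False
    have "N * n ^ 2 = 2 * (N * (\<Sum>k<n. k)) + N * n"
      unfolding sum_lessThan_id[symmetric] by (simp add: algebra_simps)
    hence e: "h ^ (N * n ^ 2) = q ^ (N * (\<Sum>k<n. k)) * h ^ (N * n)"
      by (simp only: power_add power_mult[of h 2] h)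
    have "qpinf q q ^ (N - 1) / fact N * moment q {..<N} (h * x) (int n) =
       (qpinf q q ^ (N - 1) / fact N * avg {..<N} (weyl q {..<N})) *
       ((-1) ^ (N * n) * (q ^ (N * (\<Sum>k<n. k)) * h ^ (N * n)) * x ^ (N * n) / qpoch q q n)"
      unfolding moment_nat[OF q False index_set(1,2)] by (simp add: power_mult_distrib mult_ac)
    thus ?thesis
      unfolding C e by simp
  qed
qed

lemma moment1_term:
  "qpinf q q ^ (N - 1) / fact N * moment1 q {..<N} (h * x) (int (Suc n)) =
     (-1) ^ (N * n + (N - 1)) * h ^ (N * n ^ 2 + 2 * (N - 1) * n + (N - 1)) * x ^ (N * n + (N - 1)) / qpoch q q n"
proof (cases "q = 0")
  case True
  hence "h = 0"
    using h by simp
  thus ?thesis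
    using N moment1_at_0[OF q, of "{..<N}"] by simp
next
  case False
  hence z: "h * x \<noteq> 0"
    using h x by auto
  have C: "qpinf q q ^ (N - 1) / fact N * avg {..<N} (weyl q {..<N}) = 1"
    using avg_weyl[OF q index_set(3)] qpinf_self_nz[OF q] N by simp
  have "N * n ^ 2 + 2 * (N - 1) * n + (N - 1) = 2 * (N * (\<Sum>k<n. k) + (N - 1) * n) + (N * n + (N - 1))"
    unfolding sum_lessThan_id[symmetric] by (simp add: algebra_simps)
  hence e: "h ^ (N * n ^ 2 + 2 * (N - 1) * n + (N - 1)) =
            q ^ (N * (\<Sum>k<n. k) + (N - 1) * n) * h ^ (N * n + (N - 1))"
    by (simp only: power_add[of h "2 * _"] power_mult[of h 2] h)
  have "qpinf q q ^ (N - 1) / fact N * moment1 q {..<N} (h * x) (int (Suc n)) =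
     (qpinf q q ^ (N - 1) / fact N * avg {..<N} (weyl q {..<N})) *
     ((-1) ^ (N * n + (N - 1)) * (q ^ (N * (\<Sum>k<n. k) + (N - 1) * n) * h ^ (N * n + (N - 1))) *
       x ^ (N * n + (N - 1)) / qpoch q q n)"
    unfolding moment1_nat[OF q False index_set(1,2) z] by (simp add: power_mult_distrib mult_ac)
  thus ?thesis
    unfolding C e by simp
qed

lemma moment_neg_eq_0: "moment q {..<N} (h * x) (- int (Suc n)) = 0"
proof (cases "q = 0")
  case True
  thus ?thesis
    using h moment_at_0[OF q index_set(1,2), of "- int (Suc n)"] by simp
next
  case False
  thus ?thesis
    using h x by (intro moment_neg q index_set) auto
qed

lemma moment1_nonpos_eq_0: "moment1 q {..<N} (h * x) (- int n) = 0"
proof (cases "q = 0")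
  case True
  thus ?thesis
    using h N moment1_at_0[OF q, of "{..<N}"] by simp
next
  case False
  thus ?thesis
    using h x moment1_neg[OF q False index_set(1,2), of "h * x"] by (cases n) auto
qed

lemma index_sums:
  "(\<lambda>n. (-1) ^ (N * n) * h ^ (N * n ^ 2) * x ^ (N * n) / qpoch q q n) sums index_II N x q h"
proof -
  let ?F = "\<lambda>s. weyl q {..<N} s * matter q {..<N} (h * x) s"
  have "torusfn {..<N} ?F"
    by (intro torusfn_mult torusfn_weyl torusfn_matter q)
  then obtain S1 S2 where S: "(\<lambda>n. moment q {..<N} (h * x) (int n)) sums S1"
    "(\<lambda>n. moment q {..<N} (h * x) (- int (Suc n))) sums S2"
    "avg {..<N-1} (\<lambda>s. ?F (s(N - 1 := inverse (\<Prod>i<N-1. s i)))) = S1 + S2"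
    using avg_subtorus[of "N - 1" "{..<N-1}" ?F] unfolding index_set(4)
    by (auto simp: moment_def mult.assoc)
  have "S2 = 0"
    using S(2) unfolding moment_neg_eq_0 by (metis sums_unique2 sums_zero)
  \<comment> \<open>The sum of zeroth powers is \<open>N\<close>, which the division in
    \<open>index_II\<close> removes.\<close>
  have "wilson N 0 x q h = qpinf q q ^ (N - 1) / fact N * (of_nat N * S1)"
    using S(3) \<open>S2 = 0\<close> unfolding wilson_eq_avg[OF q N]
    by (simp add: avg_cmult mult.commute[of _ "of_nat N"] del: fun_upd_apply)
  hence "index_II N x q h = qpinf q q ^ (N - 1) / fact N * S1"
    using N by (simp add: index_II_def)
  thus ?thesis
    using sums_mult[OF S(1), of "qpinf q q ^ (N - 1) / fact N"] by (simp only: moment_term)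
qed

lemma wilson_1_sums:
  "(\<lambda>n. (-1) ^ (N * n + (N - 1)) * h ^ (N * n ^ 2 + 2 * (N - 1) * n + (N - 1))
          * x ^ (N * n + (N - 1)) / qpoch q q n) sums wilson N 1 x q h"
proof -
  let ?F = "\<lambda>s. weyl q {..<N} s * (\<Sum>i<N. s i) * matter q {..<N} (h * x) s"
  have "torusfn {..<N} ?F"
    by (intro torusfn_mult torusfn_weyl torusfn_matter torusfn_sum torusfn_coord q)
  then obtain S1 S2 where S: "(\<lambda>n. moment1 q {..<N} (h * x) (int n)) sums S1"
    "(\<lambda>n. moment1 q {..<N} (h * x) (- int (Suc n))) sums S2"
    "avg {..<N-1} (\<lambda>s. ?F (s(N - 1 := inverse (\<Prod>i<N-1. s i)))) = S1 + S2"
    using avg_subtorus[of "N - 1" "{..<N-1}" ?F] unfolding index_set(4)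
    by (auto simp: moment1_def mult.assoc)
  have "S2 = 0"
    using S(2) unfolding moment1_nonpos_eq_0 by (metis sums_unique2 sums_zero)
  \<comment> \<open>The term of index 0 vanishes, so the series may be reindexed to start at
    1.\<close>
  have "(\<lambda>n. moment1 q {..<N} (h * x) (int (Suc n))) sums S1"
    using S(1) moment1_nonpos_eq_0[of 0] by (subst sums_Suc_iff) simp
  moreover have "wilson N 1 x q h = qpinf q q ^ (N - 1) / fact N * S1"
    using S(3) \<open>S2 = 0\<close> unfolding wilson_eq_avg[OF q N]
    by (simp add: mult_ac del: fun_upd_apply)
  ultimately show ?thesis
    using sums_mult[of "\<lambda>n. moment1 q {..<N} (h * x) (int (Suc n))" S1 "qpinf q q ^ (N - 1) / fact N"]
    by (simp only: moment1_term)
qed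

end

theorem theorem1p3:
  fixes N :: nat and x q h :: complex
  assumes "N \<ge> 2" and "norm q < 1" and "h ^ 2 = q" and "x \<noteq> 0"
  shows "(index_II N x q h =
           (\<Sum>n. (-1) ^ (N * n) * h ^ (N * n ^ 2) * x ^ (N * n) / qpoch q q n)) \<and>
         (wilson N 1 x q h =
           (\<Sum>n. (-1) ^ (N * n + (N - 1)) * h ^ (N * n ^ 2 + 2 * (N - 1) * n + (N - 1))
                  * x ^ (N * n + (N - 1)) / qpoch q q n))"
  \<comment> \<open>Both inputs are \<open>sums\<close> facts, so the series converge and the
    infinite sums in the statement are genuine values.\<close>
  using index_sums[OF assms] wilson_1_sums[OF assms] by (simp only: sums_iff)

end
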